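(* There exist absolute constants $\gamma,\eta\in(0,1)$ and $c>0$ such that the following holds for every $n\ge 4.5\cdot10^{16}$ and every $0<\varepsilon<e^{-11}$. Let $\mathcal A$ be a randomized algorithm which, given an explicit element $x\in\{0,1\}^n$ and prefix conditional sampling oracle access to a distribution $\mu$ over $\{0,1\}^n$, outputs a real number $\mathcal A(\mu,x)$, and suppose that for every distribution $\mu$ over $\{0,1\}^n$ there is a set $G_\mu\subseteq\{0,1\}^n$ with $\mu(G_\mu)>1-\gamma$ such that for every $x\in G_\mu$, $\Pr\big[(1-\varepsilon)\mu(x)\le\mathcal A(\mu,x)\le(1+\varepsilon)\mu(x)\big]>1-\eta$. Then there exists an input $(\mu,x)$ on which the expected number of prefix conditional samples made by $\mathcal A$ is at least $c\,n^2/\varepsilon^2$.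
   Context: A prefix conditional sampling oracle for a distribution $\mu$ over $\{0,1\}^n$ takes a string $w\in\bigcup_{i=0}^{n-1}\{0,1\}^i$ and returns an independent sample from $\mu$ conditioned on the first $|w|$ bits being $w$ (if this event has probability $0$, the output is only guaranteed to start with $w$). *)

theory Defs
  imports "HOL-Probability.Probability" "HOL-Library.Sublist"
begin

type_synonym bits = "bool list"

definition cube :: "nat \<Rightarrow> bits set" where
  "cube n = {x. length x = n}"

text \<open>
  Prefix conditional sampling oracles for the distribution \<open>\<mu>\<close>, given by the law of the sample
  returned on each prefix. If the prefix has probability 0 under \<open>\<mu>\<close>, the law is unspecified except
  that it is supported on extensions of the prefix, so \<open>\<mu>\<close> may have several such oracles.
\<close>

definition prefix_oracle :: "nat \<Rightarrow> bits pmf \<Rightarrow> (bits \<Rightarrow> bits pmf) \<Rightarrow> bool" where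
  "prefix_oracle n \<mu> orc \<longleftrightarrow>
     (\<forall>w. length w < n \<longrightarrow>
        set_pmf (orc w) \<subseteq> {y \<in> cube n. prefix w y} \<and>
        (measure_pmf.prob \<mu> {y. prefix w y} > 0 \<longrightarrow> orc w = cond_pmf \<mu> {y. prefix w y}))"

text \<open>
  A randomized algorithm is a random choice of a deterministic adaptive algorithm. The internal
  randomness is an arbitrary probability measure on (any sigma-algebra over) the reals. Given a
  seed \<open>r\<close>, the input \<open>x\<close> and the list \<open>h\<close> of samples received so far, \<open>query A r x h\<close> is
  \<open>Some w\<close> if the next step is to ask the oracle for a sample with prefix \<open>w\<close>, and \<open>None\<close> if
  the algorithm stops, in which case its output is \<open>result A r x h\<close>. Earlier queries need not be
  part of \<open>h\<close>, being determined by \<open>r\<close>, \<open>x\<close> and \<open>h\<close>. No bound on the number of queries is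
  imposed, and the algorithm may even run forever.
\<close>

record prefix_algorithm =
  coins :: "real measure"
  query :: "real \<Rightarrow> bits \<Rightarrow> bits list \<Rightarrow> bits option"
  result :: "real \<Rightarrow> bits \<Rightarrow> bits list \<Rightarrow> real"

definition randomized_algorithm :: "nat \<Rightarrow> prefix_algorithm \<Rightarrow> bool" where
  "randomized_algorithm n A \<longleftrightarrow>
     prob_space (coins A) \<and>
     (\<forall>x\<in>cube n. \<forall>h.
        (\<lambda>r. query A r x h) \<in> measurable (coins A) (count_space UNIV) \<and>
        (\<lambda>r. result A r x h) \<in> borel_measurable (coins A)) \<and>
     (\<forall>r\<in>space (coins A). \<forall>x\<in>cube n. \<forall>h w. query A r x h = Some w \<longrightarrow> length w < n)"

text \<open>
  Sample space of an execution: the seed together with mutually independent oracle responses, where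
  coordinate \<open>(t, w)\<close> is the response given if the query in step \<open>t\<close> is \<open>w\<close>.
\<close>

definition execution_space ::
    "prefix_algorithm \<Rightarrow> (bits \<Rightarrow> bits pmf) \<Rightarrow> (real \<times> (nat \<times> bits \<Rightarrow> bits)) measure" where
  "execution_space A orc =
     coins A \<Otimes>\<^sub>M (\<Pi>\<^sub>M (t, w) \<in> UNIV. measure_pmf (orc w))"

text \<open>The samples received during the first \<open>t\<close> steps; constant once the algorithm has stopped.\<close>

primrec samples ::
    "prefix_algorithm \<Rightarrow> bits \<Rightarrow> real \<times> (nat \<times> bits \<Rightarrow> bits) \<Rightarrow> nat \<Rightarrow> bits list" where
  "samples A x \<omega> 0 = []"
| "samples A x \<omega> (Suc t) =
     (case query A (fst \<omega>) x (samples A x \<omega> t) of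
        None \<Rightarrow> samples A x \<omega> t
      | Some w \<Rightarrow> samples A x \<omega> t @ [snd \<omega> (t, w)])"

definition outputs ::
    "prefix_algorithm \<Rightarrow> bits \<Rightarrow> real \<times> (nat \<times> bits \<Rightarrow> bits) \<Rightarrow> real \<Rightarrow> bool" where
  "outputs A x \<omega> v \<longleftrightarrow>
     (\<exists>t. query A (fst \<omega>) x (samples A x \<omega> t) = None \<and>
          result A (fst \<omega>) x (samples A x \<omega> t) = v)"

definition num_samples ::
    "prefix_algorithm \<Rightarrow> bits \<Rightarrow> real \<times> (nat \<times> bits \<Rightarrow> bits) \<Rightarrow> ennreal" where
  "num_samples A x \<omega> = (SUP t. of_nat (length (samples A x \<omega> t)))"

definition expected_samples :: "prefix_algorithm \<Rightarrow> (bits \<Rightarrow> bits pmf) \<Rightarrow> bits \<Rightarrow> ennreal" where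
  "expected_samples A orc x = (\<integral>\<^sup>+ \<omega>. num_samples A x \<omega> \<partial>execution_space A orc)"

end

theory Submission
  imports Defs
begin

text \<open>
  Give every node of the binary tree an independent bias, uniform on a grid of \<open>N\<close> steps of size
  \<open>\<theta> = 1/(2N)\<close> in \<open>[1/4, 3/4]\<close>, with \<open>N \<approx> n/(6\<epsilon>)\<close>. Moving all \<open>n\<close> biases on the path to \<open>x\<close> one grid step
  towards \<open>x\<close> multiplies \<open>\<mu>(x)\<close> by at least \<open>1 + 4\<epsilon>\<close>, so no number approximates both values. This
  shift almost preserves the joint law of \<open>(\<mu>, x)\<close> with \<open>x \<sim> \<mu>\<close>: it only fails when one of \<open>n\<close> biases
  is at the end of the grid, which has probability \<open>O(n/N) = O(\<epsilon>)\<close>. Hence some \<open>x\<close> is good both for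
  \<open>\<mu>\<close> and for its shift, and the algorithm distinguishes the two. But a prefix conditional sample
  leaves the path to \<open>x\<close> after \<open>O(1)\<close> levels in expectation, so it contributes only a factor
  \<open>1 + O(\<theta>\<^sup>2)\<close> to the second moment of the likelihood ratio, and \<open>\<Omega>(1/\<theta>\<^sup>2) = \<Omega>(n\<^sup>2/\<epsilon>\<^sup>2)\<close> samples are needed.
\<close>

section \<open>Second moment bounds\<close>

text \<open>Cauchy-Schwarz in Engel form: the difference of the two sides is a square divided by
  \<open>s * t\<close>.\<close>

lemma cauchy_two_weights:
  fixes u v s t :: real
  assumes "s > 0" "t > 0"
  shows "(u + v)\<^sup>2 \<le> (s + t) * (u\<^sup>2 / s + v\<^sup>2 / t)"
proof -
  have "(s + t) * (u\<^sup>2 / s + v\<^sup>2 / t) - (u + v)\<^sup>2 = (u * t - v * s)\<^sup>2 / (s * t)"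
    using assms by (simp add: field_simps power2_eq_square)
  moreover have "(u * t - v * s)\<^sup>2 / (s * t) \<ge> 0"
    using assms by simp
  ultimately show ?thesis by linarith
qed

text \<open>
  Equivalent to \<open>\<Sum>y. p(y)\<^sup>2 / q(y) \<le> M\<close> (one plus the chi-square divergence), but in a form that
  composes along adaptive executions without mentioning densities.
\<close>

definition chi_bound :: "real \<Rightarrow> 'a pmf \<Rightarrow> 'a pmf \<Rightarrow> bool" where
  "chi_bound M p q \<longleftrightarrow>
     (\<forall>g :: 'a \<Rightarrow> real. (measure_pmf.expectation p g)\<^sup>2 \<le> M * measure_pmf.expectation q (\<lambda>y. (g y)\<^sup>2))"

text \<open>The variance of \<open>g\<close> is nonnegative; finite support makes every
  \<open>g\<close> integrable.\<close>

lemma chi_bound_refl: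
  assumes "finite (set_pmf p)" "M \<ge> 1"
  shows "chi_bound M p p"
  unfolding chi_bound_def
proof
  fix g :: "'a \<Rightarrow> real"
  have int: "integrable p f" for f :: "'a \<Rightarrow> real"
    using assms(1) by (rule integrable_measure_pmf_finite)
  have "0 \<le> measure_pmf.variance p g"
    by simp
  then have "(measure_pmf.expectation p g)\<^sup>2 \<le> measure_pmf.expectation p (\<lambda>y. (g y)\<^sup>2)"
    using measure_pmf.variance_eq[OF int int] by simp
  also have "\<dots> \<le> M * \<dots>"
    using assms(2) mult_right_mono[of 1 M "measure_pmf.expectation p (\<lambda>y. (g y)\<^sup>2)"] by simp
  finally show "(measure_pmf.expectation p g)\<^sup>2 \<le> M * measure_pmf.expectation p (\<lambda>y. (g y)\<^sup>2)" .
qed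

text \<open>Data processing: a test function \<open>g\<close> on the image is the test function
  \<open>g \<circ> f\<close> on the source.\<close>

lemma chi_bound_map: "chi_bound M p q \<Longrightarrow> chi_bound M (map_pmf f p) (map_pmf f q)"
  by (simp add: chi_bound_def)

lemma expectation_bind_finite:
  fixes g :: "'b \<Rightarrow> real"
  assumes "finite (set_pmf p)" "\<And>x. finite (set_pmf (k x))"
  shows "measure_pmf.expectation (bind_pmf p k) g =
    measure_pmf.expectation p (\<lambda>x. measure_pmf.expectation (k x) g)"
  using assms by (simp add: pmf_expectation_bind[of "set_pmf p"] integral_measure_pmf[of "set_pmf p"])

text \<open>The outer bound is applied to the test function that sends \<open>x\<close> to the mean
  of \<open>g\<close> under \<open>k x\<close>, and the inner bound then to each \<open>x\<close>.
  Factors thus multiply over the steps of an adaptive process.\<close>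

lemma chi_bound_bind:
  assumes "chi_bound M p q" "M \<ge> 0" "M' \<ge> 0"
    and "finite (set_pmf p)" "finite (set_pmf q)"
    and k: "\<And>x. finite (set_pmf (k x))" and l: "\<And>x. finite (set_pmf (l x))"
    and kl: "\<And>x. chi_bound M' (k x) (l x)"
  shows "chi_bound (M * M') (bind_pmf p k) (bind_pmf q l)"
  unfolding chi_bound_def
proof
  fix g :: "'b \<Rightarrow> real"
  have int: "integrable q f" for f :: "'a \<Rightarrow> real"
    using assms(5) by (rule integrable_measure_pmf_finite)
  have "(measure_pmf.expectation (bind_pmf p k) g)\<^sup>2
      = (measure_pmf.expectation p (\<lambda>x. measure_pmf.expectation (k x) g))\<^sup>2"
    using assms by (simp add: expectation_bind_finite)
  also have "\<dots> \<le> M * measure_pmf.expectation q (\<lambda>x. (measure_pmf.expectation (k x) g)\<^sup>2)"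
    using assms(1) unfolding chi_bound_def by blast
  also have "\<dots> \<le> M * measure_pmf.expectation q
      (\<lambda>x. M' * measure_pmf.expectation (l x) (\<lambda>y. (g y)\<^sup>2))"
    using kl \<open>M \<ge> 0\<close> unfolding chi_bound_def
    by (intro mult_left_mono integral_mono int) blast+
  also have "\<dots> = (M * M') * measure_pmf.expectation (bind_pmf q l) (\<lambda>y. (g y)\<^sup>2)"
    using assms by (simp add: expectation_bind_finite)
  finally show "(measure_pmf.expectation (bind_pmf p k) g)\<^sup>2
    \<le> M * M' * measure_pmf.expectation (bind_pmf q l) (\<lambda>y. (g y)\<^sup>2)" .
qed

section \<open>Tree distributions\<close>

primrec tree_pmf :: "nat \<Rightarrow> (bits \<Rightarrow> real) \<Rightarrow> bits pmf" where
  "tree_pmf 0 p = return_pmf []"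
| "tree_pmf (Suc m) p =
     bind_pmf (bernoulli_pmf (p [])) (\<lambda>b. map_pmf ((#) b) (tree_pmf m (\<lambda>v. p (b # v))))"

lemma finite_cube [simp]: "finite (cube n)"
  using finite_lists_length_eq[of "UNIV :: bool set" n] by (simp add: cube_def)

lemma set_tree_pmf: "set_pmf (tree_pmf m p) \<subseteq> cube m"
  by (induction m arbitrary: p) (force simp: cube_def)+

lemma finite_set_tree_pmf [simp]: "finite (set_pmf (tree_pmf m p))"
  using set_tree_pmf finite_cube by (rule finite_subset)

lemma pmf_tree_Cons:
  "pmf (tree_pmf (Suc m) p) (b # y) = pmf (bernoulli_pmf (p [])) b * pmf (tree_pmf m (\<lambda>v. p (b # v))) y"
proof -
  have "pmf (tree_pmf (Suc m) p) (b # y) =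
     (\<Sum>a\<in>UNIV. pmf (bernoulli_pmf (p [])) a * pmf (map_pmf ((#) a) (tree_pmf m (\<lambda>v. p (a # v)))) (b # y))"
    unfolding tree_pmf.simps pmf_bind by (subst integral_measure_pmf[of UNIV]) auto
  also have "\<dots> = (\<Sum>a\<in>{b}. pmf (bernoulli_pmf (p [])) a * pmf (map_pmf ((#) a) (tree_pmf m (\<lambda>v. p (a # v)))) (b # y))"
    by (intro sum.mono_neutral_right) (auto simp: set_pmf_iff[symmetric] pmf_eq_0_set_pmf)
  also have "\<dots> = pmf (bernoulli_pmf (p [])) b * pmf (tree_pmf m (\<lambda>v. p (b # v))) y"
    by (simp add: pmf_map_inj' inj_def)
  finally show ?thesis .
qed

lemma pmf_tree_append:
  "pmf (tree_pmf (length w + m) p) (w @ y) =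
    (\<Prod>i<length w. pmf (bernoulli_pmf (p (take i w))) (w ! i)) * pmf (tree_pmf m (\<lambda>v. p (w @ v))) y"
proof (induction w arbitrary: p)
  case (Cons b w)
  show ?case
    unfolding append_Cons list.size add_Suc_right add_0_right add_Suc
    by (simp only: pmf_tree_Cons Cons.IH prod.lessThan_Suc_shift) (simp add: mult_ac)
qed simp

lemma pmf_tree:
  "length x = n \<Longrightarrow> pmf (tree_pmf n p) x = (\<Prod>i<n. pmf (bernoulli_pmf (p (take i x))) (x ! i))"
  using pmf_tree_append[of x 0 p "[]"] by simp

text \<open>The mass of \<open>w @ y\<close> is a factor \<open>c\<close> depending only on
  \<open>w\<close>, times the mass of \<open>y\<close> in the subtree at \<open>w\<close>. So
  \<open>c\<close> is the probability of the prefix and cancels under conditioning; it is positive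
  because all biases lie strictly between 0 and 1.\<close>

lemma cond_tree_pmf:
  assumes "length w \<le> n" "\<And>v. length v < n \<Longrightarrow> 0 < p v \<and> p v < 1"
  shows "measure_pmf.prob (tree_pmf n p) {y. prefix w y} > 0"
    and "cond_pmf (tree_pmf n p) {y. prefix w y} =
      map_pmf ((@) w) (tree_pmf (n - length w) (\<lambda>v. p (w @ v)))"
proof -
  define m where "m = n - length w"
  have n: "n = length w + m" using assms(1) by (simp add: m_def)
  define c where "c = (\<Prod>i<length w. pmf (bernoulli_pmf (p (take i w))) (w ! i))"
  define \<nu> where "\<nu> = tree_pmf m (\<lambda>v. p (w @ v))"
  have \<mu>: "pmf (tree_pmf n p) (w @ y) = c * pmf \<nu> y" for y
    unfolding n c_def \<nu>_def by (rule pmf_tree_append)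
  have inj: "inj ((@) w)" by (simp add: inj_def)
  have "measure_pmf.prob (tree_pmf n p) {y. prefix w y} = measure_pmf.prob (tree_pmf n p) ((@) w ` cube m)"
    using set_tree_pmf[of n p] n
    by (intro measure_prob_cong_0) (auto simp: cube_def prefix_def pmf_eq_0_set_pmf)
  also have "\<dots> = (\<Sum>y\<in>cube m. c * pmf \<nu> y)"
    by (simp add: measure_measure_pmf_finite sum.reindex inj_on_subset[OF inj] \<mu>)
  also have "\<dots> = c"
    by (simp add: sum_distrib_left[symmetric] sum_pmf_eq_1 \<nu>_def set_tree_pmf)
  finally have prob: "measure_pmf.prob (tree_pmf n p) {y. prefix w y} = c" .
  have "0 < p (take i w)" "p (take i w) < 1" if "i < length w" for i
    using assms that by simp_all
  then have c: "c > 0"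
    unfolding c_def by (intro prod_pos) (auto intro!: pmf_positive)
  then show "measure_pmf.prob (tree_pmf n p) {y. prefix w y} > 0"
    by (simp add: prob)
  then have ne: "set_pmf (tree_pmf n p) \<inter> {y. prefix w y} \<noteq> {}"
    by (metis measure_Int_set_pmf Int_commute measure_empty order_less_irrefl)
  show "cond_pmf (tree_pmf n p) {y. prefix w y} =
      map_pmf ((@) w) (tree_pmf (n - length w) (\<lambda>v. p (w @ v)))"
  proof (rule pmf_eqI)
    fix z
    have "pmf (map_pmf ((@) w) \<nu>) (w @ y) = pmf \<nu> y" for y
      by (rule pmf_map_inj'[OF inj])
    moreover have "pmf (map_pmf ((@) w) \<nu>) z = 0" if "\<not> prefix w z"
      using that by (auto simp: pmf_eq_0_set_pmf prefix_def)
    ultimately show "pmf (cond_pmf (tree_pmf n p) {y. prefix w y}) z =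
        pmf (map_pmf ((@) w) (tree_pmf (n - length w) (\<lambda>v. p (w @ v)))) z"
      using c by (cases "prefix w z")
        (auto simp: pmf_cond[OF ne] prob m_def[symmetric] \<nu>_def[symmetric] \<mu> elim!: prefixE)
  qed
qed

section \<open>Tilting the biases along the path to a leaf\<close>

text \<open>\<open>x ! length v\<close> is the bit by which the path to \<open>x\<close> continues
  after \<open>v\<close>, so at every node of the path the probability of staying on it rises by
  \<theta>.\<close>

definition tilt :: "real \<Rightarrow> bits \<Rightarrow> (bits \<Rightarrow> real) \<Rightarrow> bits \<Rightarrow> real" where
  "tilt \<theta> x p v = (if strict_prefix v x then p v + (if x ! length v then \<theta> else - \<theta>) else p v)"

text \<open>A subtree on the path is tilted along the rest of \<open>x\<close>, any other subtree is
  unchanged. This serves both the induction over the depth and the conditioning on a queried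
  prefix.\<close>

lemma tilt_append:
  "(\<lambda>v. tilt \<theta> x p (w @ v)) =
    (if prefix w x then tilt \<theta> (drop (length w) x) (\<lambda>v. p (w @ v)) else (\<lambda>v. p (w @ v)))"
proof (cases "prefix w x")
  case True
  then obtain x' where "x = w @ x'" by (auto simp: prefix_def)
  then show ?thesis by (auto simp: tilt_def fun_eq_iff nth_append strict_prefix_def)
next
  case False
  then have "\<not> strict_prefix (w @ v) x" for v
    by (meson append_prefixD strict_prefix_def)
  with False show ?thesis by (simp add: tilt_def)
qed

text \<open>One level of the induction over the depth: \<open>q\<close> and
  \<open>q + \<theta>\<close> are the probabilities of staying on the path before and after the
  tilt, \<open>A1\<close> and \<open>A2\<close> are first and second moments in the subtree on the
  path, \<open>B1\<close> and \<open>B2\<close> those in the other subtree.\<close>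

lemma tilt_step:
  fixes q \<theta> :: real
  assumes q: "1/4 \<le> q" "q \<le> 3/4" "1/4 \<le> q + \<theta>" "q + \<theta> \<le> 3/4" "0 \<le> \<theta>"
    and A: "A1\<^sup>2 \<le> (1 + 22 * \<theta>\<^sup>2) * A2" and B: "B1\<^sup>2 \<le> B2"
  shows "(q * A1 + (1 - q) * B1)\<^sup>2 \<le> (1 + 22 * \<theta>\<^sup>2) * ((q + \<theta>) * A2 + (1 - (q + \<theta>)) * B2)"
proof -
  define Z r where "Z = 1 + 22 * \<theta>\<^sup>2" and "r = q + \<theta>"
  have Z: "Z \<ge> 1" by (simp add: Z_def)
  have A': "A1\<^sup>2 / Z \<le> A2"
    using A[folded Z_def] Z by (simp add: pos_divide_le_eq mult.commute)
  have r: "1/4 \<le> r" "r \<le> 3/4" "q \<le> r" using q by (auto simp: r_def)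
  \<comment> \<open>This leads to the second moment of the likelihood ratio of two Bernoulli laws,
    which is \<open>1 + \<theta>^2 / (r * (1 - r))\<close>; here \<open>r * (1 - r)\<close> is at
    least 3/16.\<close>
  have "q\<^sup>2 * (1 - r) + (1 - q)\<^sup>2 * r = r * (1 - r) + \<theta>\<^sup>2"
    by (simp add: r_def algebra_simps power2_eq_square)
  then have "q\<^sup>2 / r + (1 - q)\<^sup>2 / (1 - r) = (r * (1 - r) + \<theta>\<^sup>2) / (r * (1 - r))"
    using r by (simp add: add_frac_eq)
  then have "q\<^sup>2 / r + (1 - q)\<^sup>2 / (1 - r) = 1 + \<theta>\<^sup>2 / (r * (1 - r))"
    using r by (simp add: add_divide_distrib)
  moreover have "\<theta>\<^sup>2 / (r * (1 - r)) \<le> 16/3 * \<theta>\<^sup>2"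
  proof -
    have "(r - 1/4) * (3/4 - r) \<ge> 0" using r by simp
    moreover have "(r - 1/4) * (3/4 - r) = r * (1 - r) - 3/16" by (simp add: field_simps)
    ultimately have "3/16 \<le> r * (1 - r)" by linarith
    then have "\<theta>\<^sup>2 / (r * (1 - r)) \<le> \<theta>\<^sup>2 / (3/16)" by (intro divide_left_mono) auto
    then show ?thesis by simp
  qed
  \<comment> \<open>Both \<open>q \<le> 3/4\<close> and \<open>q \<le> r\<close> hold. This factor
    below one in front of the deeper levels keeps the bound from growing with the depth.\<close>
  moreover have "q\<^sup>2 / r \<le> 3/4"
  proof -
    have "q * q \<le> 3/4 * r" using q r by (intro mult_mono) auto
    then show ?thesis using r by (simp add: power2_eq_square field_simps)
  qed
  then have "q\<^sup>2 / r * (22 * \<theta>\<^sup>2) \<le> 3/4 * (22 * \<theta>\<^sup>2)"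
    by (rule mult_right_mono) simp
  moreover have "q\<^sup>2 * Z / r = q\<^sup>2 / r + q\<^sup>2 / r * (22 * \<theta>\<^sup>2)"
    by (simp add: Z_def algebra_simps add_divide_distrib)
  \<comment> \<open>Since 16/3 + (3/4) * 22 = 131/6 is at most 22, the constant 22 reproduces itself
    from one level to the next.\<close>
  ultimately have st: "q\<^sup>2 * Z / r + (1 - q)\<^sup>2 / (1 - r) \<le> Z"
    using zero_le_power2[of \<theta>] unfolding Z_def by linarith
  \<comment> \<open>The weights are chosen so that dividing by them leaves the coefficients
    \<open>r\<close> and \<open>1 - r\<close> of the tilted law.\<close>
  have "(q * A1 + (1 - q) * B1)\<^sup>2 \<le> (q\<^sup>2 * Z / r + (1 - q)\<^sup>2 / (1 - r)) *
      ((q * A1)\<^sup>2 / (q\<^sup>2 * Z / r) + ((1 - q) * B1)\<^sup>2 / ((1 - q)\<^sup>2 / (1 - r)))"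
    using q r Z by (intro cauchy_two_weights) auto
  also have "(q * A1)\<^sup>2 / (q\<^sup>2 * Z / r) + ((1 - q) * B1)\<^sup>2 / ((1 - q)\<^sup>2 / (1 - r))
      = r * (A1\<^sup>2 / Z) + (1 - r) * B1\<^sup>2"
    using q r Z by (simp add: power_mult_distrib)
  also have "(q\<^sup>2 * Z / r + (1 - q)\<^sup>2 / (1 - r)) * (r * (A1\<^sup>2 / Z) + (1 - r) * B1\<^sup>2)
      \<le> Z * (r * (A1\<^sup>2 / Z) + (1 - r) * B1\<^sup>2)"
    using st r Z by (intro mult_right_mono add_nonneg_nonneg mult_nonneg_nonneg) auto
  also have "\<dots> \<le> Z * (r * A2 + (1 - r) * B2)"
    using A' B r Z by (intro mult_left_mono add_mono) auto
  finally show ?thesis by (simp only: Z_def r_def)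
qed

lemma expectation_tree_Suc:
  fixes g :: "bits \<Rightarrow> real"
  assumes "0 \<le> p []" "p [] \<le> 1"
  shows "measure_pmf.expectation (tree_pmf (Suc m) p) g =
    p [] * measure_pmf.expectation (tree_pmf m (\<lambda>v. p (True # v))) (\<lambda>y. g (True # y)) +
    (1 - p []) * measure_pmf.expectation (tree_pmf m (\<lambda>v. p (False # v))) (\<lambda>y. g (False # y))"
  using assms by (simp add: expectation_bind_finite mult.commute)

text \<open>
  The bound does not depend on the depth of the tree: a sample leaves the tilted path at each level
  with probability at least 1/4, so it reveals information about only boundedly many tilted nodes.
\<close>

lemma chi_bound_tilt:
  assumes "0 \<le> \<theta>"
    and "\<And>v. length v < length x \<Longrightarrow> p v \<in> {1/4..3/4}"
    and "\<And>v. length v < length x \<Longrightarrow> tilt \<theta> x p v \<in> {1/4..3/4}"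
  shows "chi_bound (1 + 22 * \<theta>\<^sup>2) (tree_pmf (length x) p) (tree_pmf (length x) (tilt \<theta> x p))"
  using assms(2,3)
proof (induction x arbitrary: p)
  case Nil
  then show ?case by (auto intro!: chi_bound_refl)
next
  case (Cons a x)
  have tc: "(\<lambda>v. tilt \<theta> (a # x) p (b # v)) = (if a = b then tilt \<theta> x (\<lambda>v. p (b # v)) else (\<lambda>v. p (b # v)))"
    for b using tilt_append[of \<theta> "a # x" p "[b]"] by auto
  have tn: "tilt \<theta> (a # x) p [] = (if a then p [] + \<theta> else p [] - \<theta>)"
    by (simp add: tilt_def)
  have IH: "chi_bound (1 + 22 * \<theta>\<^sup>2) (tree_pmf (length x) (\<lambda>v. p (a # v)))
      (tree_pmf (length x) (tilt \<theta> x (\<lambda>v. p (a # v))))"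
  proof (rule Cons.IH)
    fix v :: bits assume v: "length v < length x"
    show "p (a # v) \<in> {1/4..3/4}" using v Cons.prems(1)[of "a # v"] by simp
    show "tilt \<theta> x (\<lambda>v. p (a # v)) v \<in> {1/4..3/4}"
      using v Cons.prems(2)[of "a # v"] fun_cong[OF tc[of a], of v] by simp
  qed
  \<comment> \<open>The tilt does not touch the subtree off the path, so no factor is lost
    there.\<close>
  have same: "chi_bound 1 (tree_pmf (length x) (\<lambda>v. p ((\<not> a) # v))) (tree_pmf (length x) (\<lambda>v. p ((\<not> a) # v)))"
    by (intro chi_bound_refl) auto
  have p: "1/4 \<le> p []" "p [] \<le> 3/4" "1/4 \<le> tilt \<theta> (a # x) p []" "tilt \<theta> (a # x) p [] \<le> 3/4"
    using Cons.prems(1)[of "[]"] Cons.prems(2)[of "[]"] by auto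
  show ?case
    unfolding chi_bound_def
  proof
    fix g :: "bits \<Rightarrow> real"
    let ?E1 = "\<lambda>b. measure_pmf.expectation (tree_pmf (length x) (\<lambda>v. p (b # v))) (\<lambda>y. g (b # y))"
    let ?E2 = "\<lambda>b. measure_pmf.expectation (tree_pmf (length x) (\<lambda>v. tilt \<theta> (a # x) p (b # v))) (\<lambda>y. (g (b # y))\<^sup>2)"
    have A: "(?E1 a)\<^sup>2 \<le> (1 + 22 * \<theta>\<^sup>2) * ?E2 a"
      using IH unfolding chi_bound_def tc by simp
    have B: "(?E1 (\<not> a))\<^sup>2 \<le> ?E2 (\<not> a)"
      using same unfolding chi_bound_def tc by simp
    show "(measure_pmf.expectation (tree_pmf (length (a # x)) p) g)\<^sup>2 \<le> (1 + 22 * \<theta>\<^sup>2) *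
        measure_pmf.expectation (tree_pmf (length (a # x)) (tilt \<theta> (a # x) p)) (\<lambda>y. (g y)\<^sup>2)"
    proof (cases a)
      case True
      then show ?thesis
        using tilt_step[of "p []" \<theta>, OF _ _ _ _ \<open>0 \<le> \<theta>\<close> A B] p tn
        by (simp add: expectation_tree_Suc del: tree_pmf.simps)
    next
      case False
      \<comment> \<open>The path now follows the bit \<open>False\<close>, whose probability
        \<open>1 - p []\<close> is what the tilt raises by \<theta>, so this probability takes the
        role of \<open>q\<close>.\<close>
      have eq: "1 - (p [] - \<theta>) = \<theta> + (1 - p [])" by simp
      from False show ?thesis
        using tilt_step[of "1 - p []" \<theta>, OF _ _ _ _ \<open>0 \<le> \<theta>\<close> A B] p tn
        by (simp add: expectation_tree_Suc eq add.commute del: tree_pmf.simps)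
    qed
  qed
qed

section \<open>The law of an execution\<close>

abbreviation response_space :: "(bits \<Rightarrow> bits pmf) \<Rightarrow> (nat \<times> bits \<Rightarrow> bits) measure" where
  "response_space orc \<equiv> \<Pi>\<^sub>M (t, w) \<in> UNIV. measure_pmf (orc w)"

lemma product_prob_space_responses: "product_prob_space (\<lambda>(t :: nat, w :: bits). measure_pmf (orc w :: bits pmf))"
  by (auto simp: product_prob_space_def product_prob_space_axioms_def product_sigma_finite_def
      split: prod.split intro: prob_space_measure_pmf prob_space_imp_sigma_finite)

lemma space_response_space [simp]: "space (response_space orc) = UNIV"
  by (auto simp: space_PiM split: prod.split)

lemma prob_space_response_space: "prob_space (response_space orc)"
  by (rule prob_space_PiM) (auto split: prod.split intro: prob_space_measure_pmf)

lemma measurable_response [measurable]: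
  "(\<lambda>\<omega>. \<omega> j) \<in> measurable (response_space orc) (count_space UNIV)"
proof -
  have "(\<lambda>\<omega>. \<omega> j) \<in> measurable (response_space orc) ((\<lambda>(t, w). measure_pmf (orc w)) j)"
    by (rule measurable_component_singleton) simp
  then show ?thesis
    by (cases j) (simp add: measurable_def)
qed

lemma space_execution_space: "space (execution_space A orc) = space (coins A) \<times> UNIV"
  by (simp add: execution_space_def space_pair_measure)

lemma prob_space_execution_space:
  assumes "randomized_algorithm n A"
  shows "prob_space (execution_space A orc)"
proof -
  interpret C: prob_space "coins A"
    using assms by (simp add: randomized_algorithm_def)
  interpret R: prob_space "response_space orc"
    by (rule prob_space_response_space)
  interpret P: pair_prob_space "coins A" "response_space orc" ..
  show ?thesis
    unfolding execution_space_def by (rule P.prob_space_axioms)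
qed

text \<open>Histories and queries take countably many values, so measurability only has to be
  checked for each fixed history and query.\<close>

lemma measurable_samples:
  assumes A: "randomized_algorithm n A" and x: "x \<in> cube n"
  shows "(\<lambda>\<omega>. samples A x \<omega> t) \<in> measurable (execution_space A orc) (count_space UNIV)"
proof (induction t)
  case (Suc t)
  have q: "(\<lambda>\<omega>. query A (fst \<omega>) x h) \<in> measurable (execution_space A orc) (count_space UNIV)" for h
    using A x unfolding execution_space_def randomized_algorithm_def
    by (intro measurable_compose[OF measurable_fst]) auto
  have a: "(\<lambda>\<omega>. snd \<omega> j) \<in> measurable (execution_space A orc) (count_space UNIV)" for j
    unfolding execution_space_def by (rule measurable_compose[OF measurable_snd measurable_response])
  have "(\<lambda>\<omega>. case q of None \<Rightarrow> h | Some w \<Rightarrow> h @ [snd \<omega> (t, w)])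
      \<in> measurable (execution_space A orc) (count_space UNIV)" for h q
    using measurable_compose[OF a, of "\<lambda>y. h @ [y]" "count_space UNIV"] by (cases q) auto
  then have "(\<lambda>\<omega>. case query A (fst \<omega>) x h of None \<Rightarrow> h | Some w \<Rightarrow> h @ [snd \<omega> (t, w)])
      \<in> measurable (execution_space A orc) (count_space UNIV)" for h
    by (rule measurable_compose_countable[OF _ q])
  then show ?case
    unfolding samples.simps by (rule measurable_compose_countable[OF _ Suc])
qed simp

section \<open>Stopping by a fixed time\<close>

text \<open>\<open>outputs\<close> refers to an unbounded time; with \<open>t\<close> fixed, the
  event depends on the seed and the first \<open>t\<close> steps only.\<close>

definition stopped_in :: "prefix_algorithm \<Rightarrow> bits \<Rightarrow> real set \<Rightarrow> nat \<Rightarrow> real \<times> (nat \<times> bits \<Rightarrow> bits) \<Rightarrow> bool" where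
  "stopped_in A x I t \<omega> \<longleftrightarrow>
     query A (fst \<omega>) x (samples A x \<omega> t) = None \<and> result A (fst \<omega>) x (samples A x \<omega> t) \<in> I"

lemma outputs_iff_stopped_in: "(\<exists>v. outputs A x \<omega> v \<and> v \<in> I) \<longleftrightarrow> (\<exists>t. stopped_in A x I t \<omega>)"
  by (auto simp: outputs_def stopped_in_def)

lemma sets_stopped_in:
  assumes A: "randomized_algorithm n A" and x: "x \<in> cube n" and I: "I \<in> sets borel"
  shows "{\<omega> \<in> space (execution_space A orc). stopped_in A x I t \<omega>} \<in> sets (execution_space A orc)"
proof -
  have q: "(\<lambda>\<omega>. query A (fst \<omega>) x h) \<in> measurable (execution_space A orc) (count_space UNIV)" for h
    using A x unfolding execution_space_def randomized_algorithm_def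
    by (intro measurable_compose[OF measurable_fst]) auto
  have r: "(\<lambda>\<omega>. result A (fst \<omega>) x h) \<in> borel_measurable (execution_space A orc)" for h
    using A x unfolding execution_space_def randomized_algorithm_def
    by (intro measurable_compose[OF measurable_fst]) auto
  have "Measurable.pred (execution_space A orc)
      (\<lambda>\<omega>. query A (fst \<omega>) x h = None \<and> result A (fst \<omega>) x h \<in> I)" for h
    using q[of h] r[of h] I by measurable
  then have "Measurable.pred (execution_space A orc) (stopped_in A x I t)"
    unfolding stopped_in_def by (rule measurable_compose_countable[OF _ measurable_samples[OF A x]])
  then show ?thesis by (simp add: pred_def)
qed

lemma samples_after_stop:
  "query A (fst \<omega>) x (samples A x \<omega> t) = None \<Longrightarrow> t \<le> s \<Longrightarrow> samples A x \<omega> s = samples A x \<omega> t"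
  by (induction s) (auto simp: le_Suc_eq)

text \<open>The history is frozen once the algorithm has stopped, so both times give the same
  result, and it lies in both sets.\<close>

lemma stopped_in_unique:
  assumes "stopped_in A x I t \<omega>" "stopped_in A x J s \<omega>"
  shows "I \<inter> J \<noteq> {}"
proof -
  have "samples A x \<omega> s = samples A x \<omega> t"
    using assms samples_after_stop nat_le_linear[of t s] unfolding stopped_in_def by metis
  with assms show ?thesis by (auto simp: stopped_in_def)
qed

lemma length_samples_le: "length (samples A x \<omega> t) \<le> t"
  by (induction t) (auto split: option.split)

text \<open>Stopping is permanent, so if the algorithm still runs after \<open>t\<close> steps, each
  of them has appended a sample.\<close>

lemma length_samples_running:
  "query A (fst \<omega>) x (samples A x \<omega> t) \<noteq> None \<Longrightarrow> length (samples A x \<omega> t) = t"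
proof (induction t)
  case (Suc t)
  then show ?case
    by (cases "query A (fst \<omega>) x (samples A x \<omega> t)") auto
qed simp

section \<open>The history for a fixed seed as a discrete process\<close>

text \<open>The law of \<open>samples\<close> for the seed \<open>r\<close>, built by one fresh
  oracle sample per step. In this form \<open>chi_bound\<close> can be carried along by induction
  over the steps.\<close>

primrec run_pmf :: "prefix_algorithm \<Rightarrow> (bits \<Rightarrow> bits pmf) \<Rightarrow> bits \<Rightarrow> real \<Rightarrow> nat \<Rightarrow> bits list pmf" where
  "run_pmf A orc x r 0 = return_pmf []"
| "run_pmf A orc x r (Suc t) = bind_pmf (run_pmf A orc x r t)
     (\<lambda>h. case query A r x h of None \<Rightarrow> return_pmf h | Some w \<Rightarrow> map_pmf (\<lambda>y. h @ [y]) (orc w))"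

text \<open>
  Fixing the history \<open>h\<close> fixes the queries that led to it, so the event that the first
  \<open>t\<close> steps produce \<open>h\<close> prescribes finitely many responses, all at times before \<open>t\<close>.
\<close>

lemma samples_cylinder:
  "\<exists>J f. finite J \<and> J \<subseteq> {..<t} \<times> UNIV \<and>
     ({\<omega>. samples A x (r, \<omega>) t = h} = {} \<or>
      {\<omega>. samples A x (r, \<omega>) t = h} = {\<omega>. \<forall>j\<in>J. \<omega> j = f j})"
proof (induction t arbitrary: h)
  case 0
  show ?case
    by (intro exI[of _ "{}"]) auto
next
  case (Suc t)
  have empty: ?case if "{\<omega>. samples A x (r, \<omega>) (Suc t) = h} = {}"
    using that by (intro exI[of _ "{}"]) auto
  have run: "length h' = t" if "samples A x (r, \<omega>) t = h'" "query A r x h' \<noteq> None" for \<omega> h'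
    using that length_samples_running[of A "(r, \<omega>)" x t] by auto
  show ?case
  \<comment> \<open>A query in the last step produces a history of length \<open>Suc t\<close>, and
    without one the length is at most \<open>t\<close>. So the length of \<open>h\<close> decides
    whether the algorithm had already stopped at \<open>h\<close> or asked for the last entry of
    \<open>h\<close>.\<close>
  proof (cases "length h = Suc t")
    case False
    then have eq: "samples A x (r, \<omega>) (Suc t) = h \<longleftrightarrow> query A r x h = None \<and> samples A x (r, \<omega>) t = h" for \<omega>
      using run[of \<omega>, OF refl] by (auto split: option.split)
    show ?thesis
    proof (cases "query A r x h = None")
      case True
      obtain J f where Jf: "finite J" "J \<subseteq> {..<t} \<times> UNIV"
        "{\<omega>. samples A x (r, \<omega>) t = h} = {} \<or>
         {\<omega>. samples A x (r, \<omega>) t = h} = {\<omega>. \<forall>j\<in>J. \<omega> j = f j}"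
        using Suc.IH[of h] by blast
      moreover from Jf(2) have "J \<subseteq> {..<Suc t} \<times> UNIV" by auto
      ultimately show ?thesis
        unfolding eq using True by (intro exI[of _ J] exI[of _ f]) simp
    next
      case False
      then show ?thesis by (intro empty) (simp add: eq del: samples.simps)
    qed
  next
    case True
    then obtain h' y where h: "h = h' @ [y]" "length h' = t"
      by (metis length_Suc_conv_rev)
    have eq: "samples A x (r, \<omega>) (Suc t) = h \<longleftrightarrow>
        (\<exists>w. query A r x h' = Some w \<and> samples A x (r, \<omega>) t = h' \<and> \<omega> (t, w) = y)" for \<omega>
      using length_samples_le[of A x "(r, \<omega>)" t] True by (auto simp: h(1) split: option.split)
    show ?thesis
    proof (cases "query A r x h'")
      case None
      then show ?thesis by (intro empty) (simp add: eq del: samples.simps)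
    next
      case (Some w)
      obtain J f where Jf: "finite J" "J \<subseteq> {..<t} \<times> UNIV"
        "{\<omega>. samples A x (r, \<omega>) t = h'} = {} \<or>
         {\<omega>. samples A x (r, \<omega>) t = h'} = {\<omega>. \<forall>j\<in>J. \<omega> j = f j}"
        using Suc.IH[of h'] by blast
      have "{\<omega>. samples A x (r, \<omega>) (Suc t) = h} = {} \<or> {\<omega>. samples A x (r, \<omega>) (Suc t) = h} =
          {\<omega>. \<forall>j\<in>insert (t, w) J. \<omega> j = (f((t, w) := y)) j}"
        using Jf(3)
      proof
        assume "{\<omega>. samples A x (r, \<omega>) t = h'} = {\<omega>. \<forall>j\<in>J. \<omega> j = f j}"
        then have "samples A x (r, \<omega>) t = h' \<longleftrightarrow> (\<forall>j\<in>J. \<omega> j = f j)" for \<omega> by blast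
        \<comment> \<open>\<open>J\<close> only contains times before \<open>t\<close>, so
          prescribing the new response leaves the old constraints intact.\<close>
        moreover have "(t, w) \<notin> J" using Jf(2) by auto
        ultimately show ?thesis by (auto simp: eq Some simp del: samples.simps)
      qed (auto simp: eq simp del: samples.simps)
      moreover have "finite (insert (t, w) J)" "insert (t, w) J \<subseteq> {..<Suc t} \<times> UNIV"
        using Jf by auto
      ultimately show ?thesis by blast
    qed
  qed
qed

lemma emeasure_cylinder:
  assumes "finite J"
  shows "emeasure (response_space orc) {\<omega>. \<forall>j\<in>J. \<omega> j = f j} = (\<Prod>j\<in>J. ennreal (pmf (orc (snd j)) (f j)))"
proof -
  interpret product_prob_space "\<lambda>(t :: nat, w :: bits). measure_pmf (orc w :: bits pmf)" UNIV
    by (rule product_prob_space_responses)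
  have "emeasure (response_space orc) {\<omega> \<in> space (response_space orc). \<forall>j\<in>J. \<omega> j \<in> {f j}} =
      (\<Prod>j\<in>J. emeasure (case j of (t, w) \<Rightarrow> measure_pmf (orc w)) {f j})"
    using assms by (intro emeasure_PiM_Collect) (auto split: prod.split)
  also have "\<dots> = (\<Prod>j\<in>J. ennreal (pmf (orc (snd j)) (f j)))"
    by (intro prod.cong) (auto simp: emeasure_pmf_single split: prod.split)
  finally show ?thesis by simp
qed

text \<open>The history after \<open>t\<close> steps is a cylinder event over times before
  \<open>t\<close>, hence independent of the response at \<open>(t, w)\<close>.\<close>

lemma emeasure_samples_response:
  "emeasure (response_space orc) {\<omega>. samples A x (r, \<omega>) t = h \<and> \<omega> (t, w) = y} =
    emeasure (response_space orc) {\<omega>. samples A x (r, \<omega>) t = h} * ennreal (pmf (orc w) y)"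
proof -
  obtain J f where J: "finite J" "J \<subseteq> {..<t} \<times> UNIV" and
    Jf: "{\<omega>. samples A x (r, \<omega>) t = h} = {} \<or>
     {\<omega>. samples A x (r, \<omega>) t = h} = {\<omega>. \<forall>j\<in>J. \<omega> j = f j}"
    using samples_cylinder[of t A x r h] by blast
  from Jf show ?thesis
  proof
    assume eq: "{\<omega>. samples A x (r, \<omega>) t = h} = {\<omega>. \<forall>j\<in>J. \<omega> j = f j}"
    have new: "(t, w) \<notin> J" using J by auto
    have eq': "samples A x (r, \<omega>) t = h \<longleftrightarrow> (\<forall>j\<in>J. \<omega> j = f j)" for \<omega>
      using eq by blast
    define f' where "f' = f((t, w) := y)"
    have f': "f' (t, w) = y" "\<And>j. j \<in> J \<Longrightarrow> f' j = f j"
      using new by (auto simp: f'_def)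
    have "{\<omega>. samples A x (r, \<omega>) t = h \<and> \<omega> (t, w) = y} = {\<omega>. \<forall>j\<in>insert (t, w) J. \<omega> j = f' j}"
      unfolding eq' using f' by auto
    then have "emeasure (response_space orc) {\<omega>. samples A x (r, \<omega>) t = h \<and> \<omega> (t, w) = y} =
        (\<Prod>j\<in>insert (t, w) J. ennreal (pmf (orc (snd j)) (f' j)))"
      using emeasure_cylinder[of "insert (t, w) J" orc f'] J by simp
    also have "\<dots> = (\<Prod>j\<in>J. ennreal (pmf (orc (snd j)) (f j))) * ennreal (pmf (orc w) y)"
      using J new f' by (simp add: mult.commute)
    finally show ?thesis
      using emeasure_cylinder[OF J(1), of orc f] eq by simp
  qed auto
qed

lemma sets_samples_eq: "{\<omega>. samples A x (r, \<omega>) t = h} \<in> sets (response_space orc)"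
proof -
  obtain J f where J: "finite J" and
    Jf: "{\<omega>. samples A x (r, \<omega>) t = h} = {} \<or>
     {\<omega>. samples A x (r, \<omega>) t = h} = {\<omega>. \<forall>j\<in>J. \<omega> j = f j}"
    using samples_cylinder[of t A x r h] by blast
  have "{\<omega> \<in> space (response_space orc). \<forall>j\<in>J. \<omega> j = f j} \<in> sets (response_space orc)"
    using J by measurable
  with Jf show ?thesis by auto
qed

text \<open>The event is split by the history \<open>g\<close> one step earlier: either the
  algorithm has stopped and \<open>h = g\<close>, or \<open>h\<close> extends \<open>g\<close> by a
  response independent of the past. The sum over the countably many \<open>g\<close> is the bind in
  \<open>run_pmf\<close>.\<close>

lemma emeasure_samples_eq:
  "emeasure (response_space orc) {\<omega>. samples A x (r, \<omega>) t = h} = ennreal (pmf (run_pmf A orc x r t) h)"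
proof (induction t arbitrary: h)
  case 0
  interpret prob_space "response_space orc" by (rule prob_space_response_space)
  show ?case using emeasure_space_1 by (cases "h = []") auto
next
  case (Suc t)
  define k where "k g = (case query A r x g of None \<Rightarrow> return_pmf g | Some w \<Rightarrow> map_pmf (\<lambda>y. g @ [y]) (orc w))" for g
  define E where "E g = {\<omega>. samples A x (r, \<omega>) t = g \<and> samples A x (r, \<omega>) (Suc t) = h}" for g
  have E: "E g = {\<omega>. samples A x (r, \<omega>) t = g} \<inter> {\<omega>. samples A x (r, \<omega>) (Suc t) = h}" for g
    by (auto simp: E_def)
  have Em: "emeasure (response_space orc) (E g) = ennreal (pmf (run_pmf A orc x r t) g) * ennreal (pmf (k g) h)" for g
  proof (cases "query A r x g")
    case None
    then have "E g = (if g = h then {\<omega>. samples A x (r, \<omega>) t = g} else {})"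
      by (auto simp: E_def)
    then show ?thesis by (simp add: k_def None Suc.IH)
  next
    case (Some w)
    have step: "samples A x (r, \<omega>) (Suc t) = g @ [\<omega> (t, w)]" if "samples A x (r, \<omega>) t = g" for \<omega>
      using that Some by simp
    show ?thesis
    proof (cases "\<exists>y. h = g @ [y]")
      case True
      then obtain y where y: "h = g @ [y]" by blast
      have "E g = {\<omega>. samples A x (r, \<omega>) t = g \<and> \<omega> (t, w) = y}"
        by (auto simp: E_def y step simp del: samples.simps)
      moreover have "pmf (map_pmf (\<lambda>y. g @ [y]) (orc w)) (g @ [y]) = pmf (orc w) y"
        by (rule pmf_map_inj') (simp add: inj_def)
      ultimately show ?thesis
        by (simp add: emeasure_samples_response Suc.IH k_def Some y)
    next
      case False
      then have "E g = {}" by (auto simp: E_def step simp del: samples.simps)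
      moreover have "pmf (k g) h = 0"
        using False by (auto simp: k_def Some pmf_eq_0_set_pmf)
      ultimately show ?thesis by simp
    qed
  qed
  have "emeasure (response_space orc) {\<omega>. samples A x (r, \<omega>) (Suc t) = h} =
      emeasure (response_space orc) (\<Union>(range E))"
    by (rule arg_cong[where f = "emeasure _"]) (auto simp: E_def)
  also have "\<dots> = (\<integral>\<^sup>+g. emeasure (response_space orc) (E g) \<partial>count_space UNIV)"
    unfolding E by (intro emeasure_UN_countable sets.Int sets_samples_eq) (auto simp: disjoint_family_on_def)
  also have "\<dots> = (\<integral>\<^sup>+g. ennreal (pmf (run_pmf A orc x r t) g) * ennreal (pmf (k g) h) \<partial>count_space UNIV)"
    by (simp add: Em)
  also have "\<dots> = ennreal (pmf (run_pmf A orc x r (Suc t)) h)"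
    by (simp add: ennreal_pmf_bind nn_integral_measure_pmf k_def)
  finally show ?case .
qed

lemma emeasure_samples:
  "emeasure (response_space orc) {\<omega>. samples A x (r, \<omega>) t \<in> X} = emeasure (run_pmf A orc x r t) X"
proof -
  have m: "(\<lambda>\<omega>. samples A x (r, \<omega>) t) \<in> measurable (response_space orc) (count_space UNIV)"
    using sets_samples_eq[of A x r t]
    by (intro measurable_count_space_eq2_countable[THEN iffD2]) (auto simp: vimage_def)
  have "distr (response_space orc) (count_space UNIV) (\<lambda>\<omega>. samples A x (r, \<omega>) t) = measure_pmf (run_pmf A orc x r t)"
  proof (rule measure_eqI_countable[where A = UNIV])
    fix h
    show "emeasure (distr (response_space orc) (count_space UNIV) (\<lambda>\<omega>. samples A x (r, \<omega>) t)) {h} =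
        emeasure (run_pmf A orc x r t) {h}"
      using m by (simp add: emeasure_distr vimage_def emeasure_samples_eq emeasure_pmf_single)
  qed auto
  then have "emeasure (run_pmf A orc x r t) X =
      emeasure (distr (response_space orc) (count_space UNIV) (\<lambda>\<omega>. samples A x (r, \<omega>) t)) X"
    by simp
  also have "\<dots> = emeasure (response_space orc) {\<omega>. samples A x (r, \<omega>) t \<in> X}"
    using m by (simp add: emeasure_distr vimage_def)
  finally show ?thesis by simp
qed

section \<open>Two-point lower bound\<close>

lemma finite_set_run_pmf:
  assumes "randomized_algorithm n A" "r \<in> space (coins A)" "x \<in> cube n"
    and "\<And>w. length w < n \<Longrightarrow> finite (set_pmf (orc w))"
  shows "finite (set_pmf (run_pmf A orc x r t))"
  using assms by (induction t) (auto simp: randomized_algorithm_def split: option.split)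

text \<open>With the seed fixed, both executions ask the same query after the same history. Each
  step therefore uses either identical kernels or the two oracle laws for one prefix, and costs at
  most a factor \<open>M\<close>.\<close>

lemma chi_bound_run:
  assumes A: "randomized_algorithm n A" and r: "r \<in> space (coins A)" and x: "x \<in> cube n"
    and fin1: "\<And>w. length w < n \<Longrightarrow> finite (set_pmf (orc w))"
    and fin2: "\<And>w. length w < n \<Longrightarrow> finite (set_pmf (orc' w))"
    and chi: "\<And>w. length w < n \<Longrightarrow> chi_bound M (orc w) (orc' w)" and M: "M \<ge> 1"
  shows "chi_bound (M ^ t) (run_pmf A orc x r t) (run_pmf A orc' x r t)"
proof (induction t)
  case 0
  show ?case by (auto intro: chi_bound_refl)
next
  case (Suc t)
  have len: "length w < n" if "query A r x h = Some w" for h w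
    using A r x that by (auto simp: randomized_algorithm_def)
  have "chi_bound (M ^ t * M) (run_pmf A orc x r (Suc t)) (run_pmf A orc' x r (Suc t))"
    unfolding run_pmf.simps
  proof (rule chi_bound_bind[OF Suc])
    fix h
    show "chi_bound M
        (case query A r x h of None \<Rightarrow> return_pmf h | Some w \<Rightarrow> map_pmf (\<lambda>y. h @ [y]) (orc w))
        (case query A r x h of None \<Rightarrow> return_pmf h | Some w \<Rightarrow> map_pmf (\<lambda>y. h @ [y]) (orc' w))"
      using chi len M by (auto split: option.split intro!: chi_bound_refl chi_bound_map)
  qed (use M fin1 fin2 len finite_set_run_pmf[OF A r x] in \<open>auto split: option.split\<close>)
  then show ?case by (simp add: mult.commute)
qed

section \<open>Averaging over the seed and truncating in time\<close>

lemma emeasure_stopped_in_slice: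
  assumes "r \<in> space (coins A)"
  shows "emeasure (response_space orc)
      (Pair r -` {\<omega> \<in> space (execution_space A orc). stopped_in A x I t \<omega>}) =
    ennreal (measure_pmf.prob (run_pmf A orc x r t) {h. query A r x h = None \<and> result A r x h \<in> I})"
proof -
  have "Pair r -` {\<omega> \<in> space (execution_space A orc). stopped_in A x I t \<omega>} =
      {\<omega>. samples A x (r, \<omega>) t \<in> {h. query A r x h = None \<and> result A r x h \<in> I}}"
    using assms by (auto simp: space_execution_space stopped_in_def)
  then show ?thesis
    by (simp only: emeasure_samples measure_pmf.emeasure_eq_measure)
qed

text \<open>Tonelli over the seed: on each slice the history has the law
  \<open>run_pmf\<close>.\<close>

lemma emeasure_stopped_in:
  assumes "randomized_algorithm n A" "x \<in> cube n" "I \<in> sets borel"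
  shows "emeasure (execution_space A orc) {\<omega> \<in> space (execution_space A orc). stopped_in A x I t \<omega>} =
    (\<integral>\<^sup>+r. measure_pmf.prob (run_pmf A orc x r t) {h. query A r x h = None \<and> result A r x h \<in> I} \<partial>coins A)"
proof -
  interpret R: prob_space "response_space orc"
    by (rule prob_space_response_space)
  let ?E = "{\<omega> \<in> space (execution_space A orc). stopped_in A x I t \<omega>}"
  let ?X = "\<lambda>r. {h. query A r x h = None \<and> result A r x h \<in> I}"
  have "emeasure (execution_space A orc) ?E = (\<integral>\<^sup>+r. emeasure (response_space orc) (Pair r -` ?E) \<partial>coins A)"
    using sets_stopped_in[OF assms] unfolding execution_space_def
    by (rule R.emeasure_pair_measure_alt)
  also have "\<dots> = (\<integral>\<^sup>+r. measure_pmf.prob (run_pmf A orc x r t) (?X r) \<partial>coins A)"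
    by (intro nn_integral_cong emeasure_stopped_in_slice)
  finally show ?thesis .
qed

text \<open>The integrand is the section measure of a measurable event, which avoids tracing the
  seed through the recursion of \<open>run_pmf\<close>.\<close>

lemma borel_measurable_run_prob:
  assumes "randomized_algorithm n A" "x \<in> cube n" "I \<in> sets borel"
  shows "(\<lambda>r. ennreal (measure_pmf.prob (run_pmf A orc x r t) {h. query A r x h = None \<and> result A r x h \<in> I}))
    \<in> borel_measurable (coins A)"
proof -
  interpret R: prob_space "response_space orc"
    by (rule prob_space_response_space)
  let ?E = "{\<omega> \<in> space (execution_space A orc). stopped_in A x I t \<omega>}"
  have "(\<lambda>r. emeasure (response_space orc) (Pair r -` ?E)) \<in> borel_measurable (coins A)"
    using sets_stopped_in[OF assms] unfolding execution_space_def
    by (rule R.measurable_emeasure_Pair)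
  then show ?thesis
    by (rule measurable_cong[THEN iffD1, rotated]) (rule emeasure_stopped_in_slice)
qed

text \<open>For each seed, testing \<open>chi_bound\<close> with an indicator gives
  \<open>f^2 \<le> M^t * g\<close> for the two stopping probabilities. The inequality
  \<open>2 * f \<le> 1 + f^2\<close> makes this linear in \<open>f\<close>, so that it can be
  averaged over the seed.\<close>

lemma stopped_in_compare:
  assumes A: "randomized_algorithm n A" and x: "x \<in> cube n" and I: "I \<in> sets borel"
    and fin1: "\<And>w. length w < n \<Longrightarrow> finite (set_pmf (orc w))"
    and fin2: "\<And>w. length w < n \<Longrightarrow> finite (set_pmf (orc' w))"
    and chi: "\<And>w. length w < n \<Longrightarrow> chi_bound M (orc w) (orc' w)" and M: "M \<ge> 1"
  shows "2 * \<P>(\<omega> in execution_space A orc. stopped_in A x I t \<omega>) \<le>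
    1 + M ^ t * \<P>(\<omega> in execution_space A orc'. stopped_in A x I t \<omega>)"
proof -
  interpret C: prob_space "coins A"
    using A by (simp add: randomized_algorithm_def)
  interpret P: prob_space "execution_space A orc"
    by (rule prob_space_execution_space[OF A])
  interpret P': prob_space "execution_space A orc'"
    by (rule prob_space_execution_space[OF A])
  define X where "X r = {h. query A r x h = None \<and> result A r x h \<in> I}" for r
  define f g where "f r = measure_pmf.prob (run_pmf A orc x r t) (X r)"
    and "g r = measure_pmf.prob (run_pmf A orc' x r t) (X r)" for r
  have f: "emeasure (execution_space A orc) {\<omega> \<in> space (execution_space A orc). stopped_in A x I t \<omega>} = (\<integral>\<^sup>+r. f r \<partial>coins A)"
    and g: "emeasure (execution_space A orc') {\<omega> \<in> space (execution_space A orc'). stopped_in A x I t \<omega>} = (\<integral>\<^sup>+r. g r \<partial>coins A)"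
    unfolding f_def g_def X_def by (rule emeasure_stopped_in[OF A x I])+
  have fm [measurable]: "(\<lambda>r. ennreal (f r)) \<in> borel_measurable (coins A)"
    and gm [measurable]: "(\<lambda>r. ennreal (g r)) \<in> borel_measurable (coins A)"
    unfolding f_def g_def X_def by (rule borel_measurable_run_prob[OF A x I])+
  have le: "2 * f r \<le> 1 + M ^ t * g r" if "r \<in> space (coins A)" for r
  proof -
    have "chi_bound (M ^ t) (run_pmf A orc x r t) (run_pmf A orc' x r t)"
      using chi_bound_run[OF A that x fin1 fin2 chi M] .
    then have "(measure_pmf.expectation (run_pmf A orc x r t) (indicator (X r)))\<^sup>2 \<le>
        M ^ t * measure_pmf.expectation (run_pmf A orc' x r t) (\<lambda>h. (indicator (X r) h)\<^sup>2)"
      unfolding chi_bound_def by blast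
    moreover have "(\<lambda>h. (indicator (X r) h :: real)\<^sup>2) = indicator (X r)"
      by (auto simp: indicator_def)
    ultimately have "(f r)\<^sup>2 \<le> M ^ t * g r"
      by (simp add: f_def g_def)
    moreover have "2 * f r \<le> 1 + (f r)\<^sup>2"
      using zero_le_power2[of "f r - 1"] by (simp add: power2_diff)
    ultimately show ?thesis by linarith
  qed
  have "ennreal (2 * \<P>(\<omega> in execution_space A orc. stopped_in A x I t \<omega>)) =
      2 * (\<integral>\<^sup>+r. f r \<partial>coins A)"
    by (simp add: f[symmetric] P.emeasure_eq_measure ennreal_mult)
  also have "\<dots> = (\<integral>\<^sup>+r. ennreal (2 * f r) \<partial>coins A)"
    by (subst nn_integral_cmult[OF fm, symmetric]) (auto simp: ennreal_mult f_def)
  also have "\<dots> \<le> (\<integral>\<^sup>+r. 1 + ennreal (M ^ t) * ennreal (g r) \<partial>coins A)"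
  proof (rule nn_integral_mono)
    fix r assume "r \<in> space (coins A)"
    then have "ennreal (2 * f r) \<le> ennreal (1 + M ^ t * g r)"
      by (intro ennreal_leI le)
    also have "\<dots> = 1 + ennreal (M ^ t) * ennreal (g r)"
      using M by (simp add: ennreal_plus ennreal_mult g_def)
    finally show "ennreal (2 * f r) \<le> 1 + ennreal (M ^ t) * ennreal (g r)" .
  qed
  also have "\<dots> = 1 + ennreal (M ^ t) * (\<integral>\<^sup>+r. g r \<partial>coins A)"
    by (simp add: nn_integral_add nn_integral_cmult C.emeasure_space_1)
  also have "\<dots> = ennreal (1 + M ^ t * \<P>(\<omega> in execution_space A orc'. stopped_in A x I t \<omega>))"
    using M by (simp add: g[symmetric] P'.emeasure_eq_measure ennreal_mult ennreal_plus)
  finally show ?thesis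
    using M by (subst (asm) ennreal_le_iff) auto
qed

text \<open>Had the algorithm stopped at time \<open>t\<close>, its result would be the one seen at
  time \<open>s\<close>. So it is still running after \<open>t\<close> samples and asks for at least
  one more.\<close>

lemma running_num_samples:
  assumes "\<not> stopped_in A x I t \<omega>" "stopped_in A x I s \<omega>"
  shows "of_nat (Suc t) \<le> num_samples A x \<omega>"
proof -
  have "query A (fst \<omega>) x (samples A x \<omega> t) \<noteq> None"
  proof
    assume "query A (fst \<omega>) x (samples A x \<omega> t) = None"
    then have "stopped_in A x UNIV t \<omega>" by (simp add: stopped_in_def)
    moreover have "samples A x \<omega> s = samples A x \<omega> t"
      using assms samples_after_stop nat_le_linear[of t s]
        \<open>query A (fst \<omega>) x (samples A x \<omega> t) = None\<close>
      unfolding stopped_in_def by metis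
    ultimately show False
      using assms by (simp add: stopped_in_def)
  qed
  then have "length (samples A x \<omega> (Suc t)) = Suc t"
    using length_samples_running[of A \<omega> x t] by auto
  then have "of_nat (Suc t) = (of_nat (length (samples A x \<omega> (Suc t))) :: ennreal)"
    by simp
  also have "\<dots> \<le> num_samples A x \<omega>"
    unfolding num_samples_def by (rule SUP_upper) simp
  finally show ?thesis .
qed

text \<open>An output in \<open>I\<close> that is not reached by time \<open>t\<close> costs at
  least \<open>Suc t\<close> samples, an event that Markov's inequality bounds by
  \<open>Q / Suc t\<close>.\<close>

lemma prob_outputs_le:
  assumes A: "randomized_algorithm n A" and x: "x \<in> cube n" and I: "I \<in> sets borel"
    and Q: "expected_samples A orc x \<le> ennreal Q" "Q \<ge> 0"
  shows "\<P>(\<omega> in execution_space A orc. \<exists>v. outputs A x \<omega> v \<and> v \<in> I) \<le>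
    \<P>(\<omega> in execution_space A orc. stopped_in A x I t \<omega>) + Q / Suc t"
proof -
  let ?P = "execution_space A orc"
  interpret P: prob_space ?P
    by (rule prob_space_execution_space[OF A])
  have [measurable]: "(\<lambda>\<omega>. samples A x \<omega> s) \<in> measurable ?P (count_space UNIV)" for s
    by (rule measurable_samples[OF A x])
  have nm [measurable]: "num_samples A x \<in> borel_measurable ?P"
    unfolding num_samples_def[abs_def] by measurable
  let ?S = "{\<omega> \<in> space ?P. stopped_in A x I t \<omega>}"
  let ?B = "{\<omega> \<in> space ?P. of_nat (Suc t) \<le> num_samples A x \<omega>}"
  have B: "?B \<in> sets ?P" by measurable
  have "{\<omega> \<in> space ?P. \<exists>v. outputs A x \<omega> v \<and> v \<in> I} \<subseteq> ?S \<union> ?B"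
    using running_num_samples[of A x I t] unfolding outputs_iff_stopped_in by blast
  then have "P.prob {\<omega> \<in> space ?P. \<exists>v. outputs A x \<omega> v \<and> v \<in> I} \<le> P.prob (?S \<union> ?B)"
    using sets_stopped_in[OF A x I, of orc t] B by (intro P.finite_measure_mono sets.Un)
  also have "\<dots> \<le> P.prob ?S + P.prob ?B"
    using sets_stopped_in[OF A x I, of orc t] B by (intro measure_Un_le)
  also have "P.prob ?B \<le> Q / Suc t"
  proof -
    have "of_nat (Suc t) * emeasure ?P ?B = (\<integral>\<^sup>+\<omega>. of_nat (Suc t) * indicator ?B \<omega> \<partial>?P)"
      using B by (subst nn_integral_cmult_indicator) auto
    also have "\<dots> \<le> (\<integral>\<^sup>+\<omega>. num_samples A x \<omega> \<partial>?P)"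
      by (intro nn_integral_mono) (auto simp: indicator_def)
    also have "\<dots> \<le> ennreal Q"
      using Q(1) by (simp add: expected_samples_def)
    finally have "ennreal (real (Suc t) * P.prob ?B) \<le> ennreal Q"
      by (simp only: P.emeasure_eq_measure ennreal_of_nat_eq_real_of_nat ennreal_mult[OF of_nat_0_le_iff measure_nonneg])
    then have "real (Suc t) * P.prob ?B \<le> Q"
      using Q(2) by (subst (asm) ennreal_le_iff) auto
    then show ?thesis by (simp add: pos_le_divide_eq mult.commute)
  qed
  finally show ?thesis by simp
qed

text \<open>If at most \<open>Q\<close> samples were expected, the algorithm would stop in
  \<open>I\<close> by time \<open>t\<close> with probability above 4/5 under \<open>orc\<close>. The
  comparison then gives more than 3/10 under \<open>orc'\<close>, but the outputs in
  \<open>J\<close> leave at most 1/10.\<close>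

lemma two_point_lower_bound:
  assumes A: "randomized_algorithm n A" and x: "x \<in> cube n"
    and I: "I \<in> sets borel" and J: "J \<in> sets borel" and IJ: "I \<inter> J = {}"
    and fin1: "\<And>w. length w < n \<Longrightarrow> finite (set_pmf (orc w))"
    and fin2: "\<And>w. length w < n \<Longrightarrow> finite (set_pmf (orc' w))"
    and chi: "\<And>w. length w < n \<Longrightarrow> chi_bound M (orc w) (orc' w)" and M: "M \<ge> 1" "M ^ t \<le> 2"
    and I_prob: "\<P>(\<omega> in execution_space A orc. \<exists>v. outputs A x \<omega> v \<and> v \<in> I) > 9/10"
    and J_prob: "\<P>(\<omega> in execution_space A orc'. \<exists>v. outputs A x \<omega> v \<and> v \<in> J) > 9/10"
    and Q: "0 \<le> Q" "Q \<le> Suc t / 10"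
  shows "expected_samples A orc x > ennreal Q"
proof (rule ccontr)
  let ?P' = "execution_space A orc'"
  interpret P': prob_space ?P'
    by (rule prob_space_execution_space[OF A])
  assume "\<not> expected_samples A orc x > ennreal Q"
  then have "expected_samples A orc x \<le> ennreal Q" by simp
  from prob_outputs_le[OF A x I this Q(1), of t]
  have "9/10 < \<P>(\<omega> in execution_space A orc. stopped_in A x I t \<omega>) + Q / Suc t"
    using I_prob by linarith
  moreover have "Q / Suc t \<le> 1 / 10"
    using Q by (simp add: divide_le_eq)
  moreover have "2 * \<P>(\<omega> in execution_space A orc. stopped_in A x I t \<omega>) \<le>
      1 + M ^ t * \<P>(\<omega> in ?P'. stopped_in A x I t \<omega>)"
    by (rule stopped_in_compare[OF A x I fin1 fin2 chi M(1)])
  moreover have "M ^ t * \<P>(\<omega> in ?P'. stopped_in A x I t \<omega>) \<le>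
      2 * \<P>(\<omega> in ?P'. stopped_in A x I t \<omega>)"
    using M(2) by (intro mult_right_mono) auto
  moreover have "\<P>(\<omega> in ?P'. stopped_in A x I t \<omega>) \<le> 1 - 9/10"
  proof -
    let ?S = "{\<omega> \<in> space ?P'. stopped_in A x I t \<omega>}"
    let ?T = "{\<omega> \<in> space ?P'. \<exists>s. stopped_in A x J s \<omega>}"
    have T: "?T \<in> sets ?P'"
    proof -
      have "?T = (\<Union>s. {\<omega> \<in> space ?P'. stopped_in A x J s \<omega>})" by auto
      then show ?thesis using sets_stopped_in[OF A x J] by auto
    qed
    have "P'.prob ?S \<le> P'.prob (space ?P' - ?T)"
      using stopped_in_unique[of A x I t _ J] IJ T by (intro P'.finite_measure_mono) auto
    also have "\<dots> = 1 - P'.prob ?T"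
      using T by (rule P'.prob_compl)
    finally show ?thesis
      using J_prob unfolding outputs_iff_stopped_in by simp
  qed
  ultimately show False by linarith
qed

section \<open>Random grid trees\<close>

text \<open>
  A grid tree chooses, for each node \<open>v\<close> of the binary tree, an integer \<open>b v \<in> {0..N}\<close>; the bit
  following the prefix \<open>v\<close> is then true with probability \<open>bias N b v \<in> [1/4, 3/4]\<close>.
\<close>

definition bias :: "nat \<Rightarrow> (bits \<Rightarrow> int) \<Rightarrow> bits \<Rightarrow> real" where
  "bias N b v = 1/4 + b v / (2 * real N)"

definition grid_trees :: "nat \<Rightarrow> nat \<Rightarrow> (bits \<Rightarrow> int) set" where
  "grid_trees N n = ({v. length v < n} \<rightarrow>\<^sub>E {0..int N})"

text \<open>The integer form of \<open>tilt\<close>: one grid step changes a bias by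
  \<open>1 / (2 * real N)\<close>.\<close>

definition shift_path :: "bits \<Rightarrow> (bits \<Rightarrow> int) \<Rightarrow> bits \<Rightarrow> int" where
  "shift_path x b v = (if strict_prefix v x then b v + (if x ! length v then 1 else - 1) else b v)"

text \<open>The obstruction to shifting a grid tree: some node of the path already sits at the end
  of the grid towards which the shift would move it.\<close>

definition leaves_grid :: "nat \<Rightarrow> bits \<Rightarrow> (bits \<Rightarrow> int) \<Rightarrow> bool" where
  "leaves_grid N x b \<longleftrightarrow> (\<exists>i<length x. b (take i x) = (if x ! i then int N else 0))"

definition edge_weight :: "nat \<Rightarrow> bool \<Rightarrow> int \<Rightarrow> real" where
  "edge_weight N a k = (if a then 1/4 + k / (2 * real N) else 3/4 - k / (2 * real N))"

text \<open>The mass of \<open>x\<close> whenever \<open>b\<close> is a grid tree. As a plain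
  product it also makes sense off the grid, so shifting a grid tree increases it even where the
  shift leaves the grid.\<close>

definition path_weight :: "nat \<Rightarrow> bits \<Rightarrow> (bits \<Rightarrow> int) \<Rightarrow> real" where
  "path_weight N x b = (\<Prod>i<length x. edge_weight N (x ! i) (b (take i x)))"

lemma finite_short: "finite {v :: bits. length v < n}"
proof -
  have "{v :: bits. length v < n} = (\<Union>i<n. cube i)" by (auto simp: cube_def)
  then show ?thesis by simp
qed

lemma finite_grid_trees [simp]: "finite (grid_trees N n)"
  unfolding grid_trees_def by (intro finite_PiE finite_short) auto

lemma grid_trees_nonempty: "grid_trees N n \<noteq> {}"
  by (auto simp: grid_trees_def PiE_eq_empty_iff)

lemma grid_treesD: "b \<in> grid_trees N n \<Longrightarrow> length v < n \<Longrightarrow> 0 \<le> b v \<and> b v \<le> int N"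
  by (auto simp: grid_trees_def PiE_iff)

lemma strict_prefix_take: "i < length x \<Longrightarrow> strict_prefix (take i x) x"
  by (simp add: strict_prefix_def take_is_prefix)

lemma strict_prefixes: "{v. strict_prefix v x} = (\<lambda>i. take i x) ` {..<length x}"
proof safe
  fix v assume "strict_prefix v x"
  then have "v = take (length v) x" "length v < length x"
    by (auto simp: strict_prefix_def prefix_def)
  then show "v \<in> (\<lambda>i. take i x) ` {..<length x}" by blast
qed (auto intro: strict_prefix_take)

lemma edge_weight_bounds:
  assumes "N > 0" "0 \<le> k" "k \<le> int N"
  shows "1/4 \<le> edge_weight N a k" "edge_weight N a k \<le> 3/4"
proof -
  have "0 \<le> real_of_int k" "real_of_int k \<le> real N" using assms by simp_all
  then have "0 \<le> real_of_int k / (2 * real N)" "real_of_int k / (2 * real N) \<le> 1/2"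
    using assms by (simp_all add: divide_le_eq)
  then show "1/4 \<le> edge_weight N a k" "edge_weight N a k \<le> 3/4"
    unfolding edge_weight_def by auto
qed

lemma bias_bounds:
  assumes "N > 0" "b \<in> grid_trees N n" "length v < n"
  shows "1/4 \<le> bias N b v" "bias N b v \<le> 3/4"
  using edge_weight_bounds[of N "b v" True] grid_treesD[OF assms(2,3)] assms(1)
  by (auto simp: edge_weight_def bias_def)

lemma bias_shift: "bias N (shift_path x b) = tilt (1 / (2 * real N)) x (bias N b)"
  by (auto simp: fun_eq_iff bias_def shift_path_def tilt_def add_divide_distrib diff_divide_distrib)

lemma pmf_grid_tree:
  assumes "N > 0" "b \<in> grid_trees N n" "x \<in> cube n"
  shows "pmf (tree_pmf n (bias N b)) x = path_weight N x b"
proof -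
  have x: "length x = n" using assms by (simp add: cube_def)
  show ?thesis
    unfolding pmf_tree[OF x] path_weight_def x
  proof (rule prod.cong[OF refl])
    fix i assume "i \<in> {..<n}"
    then have "1/4 \<le> bias N b (take i x)" "bias N b (take i x) \<le> 3/4"
      using bias_bounds[OF assms(1,2), of "take i x"] x by auto
    then show "pmf (bernoulli_pmf (bias N b (take i x))) (x ! i) = edge_weight N (x ! i) (b (take i x))"
      by (cases "x ! i") (auto simp: edge_weight_def bias_def)
  qed
qed

lemma path_weight_pos:
  assumes "N > 0" "b \<in> grid_trees N n" "x \<in> cube n"
  shows "path_weight N x b > 0"
  unfolding path_weight_def
proof (rule prod_pos)
  fix i assume "i \<in> {..<length x}"
  then show "0 < edge_weight N (x ! i) (b (take i x))"
    using assms edge_weight_bounds(1)[OF assms(1), of "b (take i x)" "x ! i"] grid_treesD[OF assms(2), of "take i x"]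
    by (auto simp: cube_def)
qed

lemma shift_in_grid_trees:
  assumes b: "b \<in> grid_trees N n" and x: "x \<in> cube n" and "\<not> leaves_grid N x b"
  shows "shift_path x b \<in> grid_trees N n"
  unfolding grid_trees_def
proof (rule PiE_I)
  fix v :: bits assume v: "v \<in> {v. length v < n}"
  show "shift_path x b v \<in> {0..int N}"
  proof (cases "strict_prefix v x")
    case True
    then obtain i where "i < length x" "v = take i x" using strict_prefixes by blast
    then have "b v \<noteq> (if x ! length v then int N else 0)"
      using assms(3) by (auto simp: leaves_grid_def)
    then show ?thesis
      using grid_treesD[OF b, of v] v True by (auto simp: shift_path_def split: if_splits)
  next
    case False
    then show ?thesis using grid_treesD[OF b, of v] v by (auto simp: shift_path_def)
  qed
next
  fix v :: bits assume v: "v \<notin> {v. length v < n}"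
  then have "\<not> strict_prefix v x"
    using x by (auto simp: cube_def dest: prefix_length_less)
  then show "shift_path x b v = undefined"
    using b v by (simp add: shift_path_def grid_trees_def PiE_iff extensional_def)
qed

text \<open>The amount added at \<open>v\<close> depends on \<open>x\<close> and \<open>v\<close>
  only, so it can be subtracted again.\<close>

lemma inj_shift: "inj (shift_path x)"
proof (rule injI, rule ext)
  fix b b' v assume "shift_path x b = shift_path x b'"
  then have "shift_path x b v = shift_path x b' v" by (rule fun_cong)
  then show "b v = b' v" by (simp add: shift_path_def split: if_splits)
qed

text \<open>Every edge weight is at most 3/4, so adding \<open>1 / (2 * real N)\<close> multiplies
  it by at least \<open>1 + 2 / (3 * real N)\<close>.\<close>

lemma path_weight_shift:
  assumes N: "N > 0" and b: "b \<in> grid_trees N n" and x: "x \<in> cube n"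
  shows "(1 + 2 / (3 * real N)) ^ n * path_weight N x b \<le> path_weight N x (shift_path x b)"
proof -
  have "(1 + 2 / (3 * real N)) ^ n * path_weight N x b =
      (\<Prod>i<length x. (1 + 2 / (3 * real N)) * edge_weight N (x ! i) (b (take i x)))"
    using x by (simp add: path_weight_def prod.distrib cube_def)
  also have "\<dots> \<le> path_weight N x (shift_path x b)"
    unfolding path_weight_def
  proof (rule prod_mono, rule conjI)
    fix i assume i: "i \<in> {..<length x}"
    have w: "1/4 \<le> edge_weight N (x ! i) (b (take i x))" "edge_weight N (x ! i) (b (take i x)) \<le> 3/4"
      using edge_weight_bounds[OF N, of "b (take i x)"] grid_treesD[OF b, of "take i x"] i x
      by (auto simp: cube_def)
    then show "0 \<le> (1 + 2 / (3 * real N)) * edge_weight N (x ! i) (b (take i x))"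
      by simp
    have "2 / (3 * real N) * edge_weight N (x ! i) (b (take i x)) \<le> 2 / (3 * real N) * (3/4)"
      using w by (intro mult_left_mono) auto
    also have "\<dots> = 1 / (2 * real N)" by simp
    finally have "(1 + 2 / (3 * real N)) * edge_weight N (x ! i) (b (take i x)) \<le>
        edge_weight N (x ! i) (b (take i x)) + 1 / (2 * real N)"
      by (simp add: distrib_right)
    also have "\<dots> = edge_weight N (x ! i) (shift_path x b (take i x))"
      using i strict_prefix_take[of i x]
      by (auto simp: shift_path_def edge_weight_def add_divide_distrib diff_divide_distrib)
    finally show "(1 + 2 / (3 * real N)) * edge_weight N (x ! i) (b (take i x)) \<le>
        edge_weight N (x ! i) (shift_path x b (take i x))" .
  qed
  finally show ?thesis .
qed

lemma path_weight_mono_shift: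
  assumes "N > 0" "b \<in> grid_trees N n" "x \<in> cube n"
  shows "path_weight N x b \<le> path_weight N x (shift_path x b)"
proof -
  have "1 \<le> (1 + 2 / (3 * real N)) ^ n" by simp
  then have "1 * path_weight N x b \<le> (1 + 2 / (3 * real N)) ^ n * path_weight N x b"
    using path_weight_pos[OF assms] by (intro mult_right_mono) auto
  then show ?thesis using path_weight_shift[OF assms] by simp
qed

section \<open>How likely the shift is to leave the grid\<close>

text \<open>Values at different nodes are independent, so both sums factorise over the nodes and
  differ only in the factor of \<open>take i x\<close>. That factor is at most 3/4 on the left and
  at least \<open>real (Suc N) / 4\<close> in the full sum.\<close>

lemma sum_path_weight_at_node:
  assumes N: "N > 0" and x: "x \<in> cube n" and i: "i < n" and e: "0 \<le> e" "e \<le> int N"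
  shows "(\<Sum>b | b \<in> grid_trees N n \<and> b (take i x) = e. path_weight N x b) \<le>
    3 / real (Suc N) * (\<Sum>b\<in>grid_trees N n. path_weight N x b)"
proof -
  let ?V = "{v :: bits. length v < n}" and ?K = "{0..int N}"
  define u where "u = take i x"
  have len: "length x = n" using x by (simp add: cube_def)
  have u: "u \<in> ?V" "strict_prefix u x"
    using i len by (auto simp: u_def intro: strict_prefix_take)
  \<comment> \<open>Nodes off the path get the factor 1, which turns the path weight into a product
    over all nodes; \<open>g\<close> also carries the condition at \<open>u\<close>.\<close>
  define f where "f v k = (if strict_prefix v x then edge_weight N (x ! length v) k else 1)" for v k
  define g where "g v k = (if v = u then f v k * of_bool (k = e) else f v k)" for v k
  have path: "path_weight N x b = (\<Prod>v\<in>?V. f v (b v))" for b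
  proof -
    have "(\<Prod>v\<in>?V. f v (b v)) = (\<Prod>v | strict_prefix v x. f v (b v))"
      using len prefix_length_less by (intro prod.mono_neutral_right finite_short) (auto simp: f_def)
    also have "\<dots> = (\<Prod>i<length x. f (take i x) (b (take i x)))"
      unfolding strict_prefixes
    proof (rule prod.reindex_cong[OF _ refl refl])
      show "inj_on (\<lambda>i. take i x) {..<length x}"
        by (rule inj_onI) (auto dest!: arg_cong[of _ _ length])
    qed
    also have "\<dots> = path_weight N x b"
      unfolding path_weight_def by (intro prod.cong) (auto simp: f_def strict_prefix_take)
    finally show ?thesis ..
  qed
  have at_u: "of_bool (b u = e) * (\<Prod>v\<in>?V. f v (b v)) = (\<Prod>v\<in>?V. g v (b v))" for b
    using u by (simp add: prod.remove[of _ u] finite_short g_def mult.assoc mult.commute)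
  define R where "R = (\<Prod>v\<in>?V - {u}. \<Sum>k\<in>?K. f v k)"
  have f_pos: "1/4 \<le> f v k" if "k \<in> ?K" for v k
    using edge_weight_bounds[OF N, of k] that by (auto simp: f_def)
  have R: "R \<ge> 0"
    unfolding R_def by (intro prod_nonneg sum_nonneg order_trans[OF _ f_pos]) auto
  have "(\<Sum>b | b \<in> grid_trees N n \<and> b u = e. path_weight N x b) =
      (\<Sum>b\<in>grid_trees N n. of_bool (b u = e) * path_weight N x b)"
    by (intro sum.mono_neutral_cong_left) auto
  also have "\<dots> = (\<Prod>v\<in>?V. \<Sum>k\<in>?K. g v k)"
    unfolding path at_u grid_trees_def by (rule prod_sum_PiE[symmetric]) (auto intro: finite_short)
  also have "\<dots> = (\<Sum>k\<in>?K. g u k) * R"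
    using u finite_short[of n] by (simp add: prod.remove[of _ u] R_def g_def)
  also have "(\<Sum>k\<in>?K. g u k) = (\<Sum>k\<in>{e}. f u k)"
    using e by (intro sum.mono_neutral_cong_right) (auto simp: g_def)
  also have "\<dots> \<le> 3/4"
    using edge_weight_bounds[OF N e] u by (simp add: f_def)
  finally have num: "(\<Sum>b | b \<in> grid_trees N n \<and> b u = e. path_weight N x b) \<le> 3/4 * R"
    using R by (simp add: mult_right_mono)
  have "(\<Sum>b\<in>grid_trees N n. path_weight N x b) = (\<Prod>v\<in>?V. \<Sum>k\<in>?K. f v k)"
    unfolding path grid_trees_def by (rule prod_sum_PiE[symmetric]) (auto intro: finite_short)
  also have "\<dots> = (\<Sum>k\<in>?K. f u k) * R"
    using u finite_short[of n] by (simp add: prod.remove[of _ u] R_def)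
  finally have total: "(\<Sum>b\<in>grid_trees N n. path_weight N x b) = (\<Sum>k\<in>?K. f u k) * R" .
  have "real (Suc N) / 4 = (\<Sum>k\<in>?K. 1/4)" by simp
  also have "\<dots> \<le> (\<Sum>k\<in>?K. f u k)"
    using f_pos by (intro sum_mono) auto
  finally have "real (Suc N) / 4 * R \<le> (\<Sum>b\<in>grid_trees N n. path_weight N x b)"
    unfolding total using R by (rule mult_right_mono)
  then have "3 / real (Suc N) * (real (Suc N) / 4 * R) \<le>
      3 / real (Suc N) * (\<Sum>b\<in>grid_trees N n. path_weight N x b)"
    by (rule mult_left_mono) simp
  moreover have "3 / real (Suc N) * (real (Suc N) / 4 * R) = 3/4 * R"
    by (simp del: of_nat_Suc)
  ultimately show ?thesis
    using num by (simp add: u_def)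
qed

text \<open>Union bound over the \<open>n\<close> nodes of the path.\<close>

lemma sum_path_weight_leaves_grid:
  assumes N: "N > 0" and x: "x \<in> cube n"
  shows "(\<Sum>b | b \<in> grid_trees N n \<and> leaves_grid N x b. path_weight N x b) \<le>
    3 * real n / real (Suc N) * (\<Sum>b\<in>grid_trees N n. path_weight N x b)"
proof -
  have len: "length x = n" using x by (simp add: cube_def)
  define B where "B i = {b \<in> grid_trees N n. b (take i x) = (if x ! i then int N else 0)}" for i
  have W: "0 \<le> path_weight N x b" if "b \<in> grid_trees N n" for b
    using path_weight_pos[OF N that x] by simp
  have "(\<Sum>b | b \<in> grid_trees N n \<and> leaves_grid N x b. path_weight N x b) \<le>
      (\<Sum>b | b \<in> grid_trees N n \<and> leaves_grid N x b. \<Sum>i<n. if b \<in> B i then path_weight N x b else 0)"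
  proof (rule sum_mono)
    fix b assume "b \<in> {b. b \<in> grid_trees N n \<and> leaves_grid N x b}"
    then obtain i where "i < n" "b \<in> B i" "b \<in> grid_trees N n"
      by (auto simp: leaves_grid_def B_def len)
    then show "path_weight N x b \<le> (\<Sum>i<n. if b \<in> B i then path_weight N x b else 0)"
      using member_le_sum[of i "{..<n}" "\<lambda>i. if b \<in> B i then path_weight N x b else 0"] W by auto
  qed
  also have "\<dots> \<le> (\<Sum>b\<in>grid_trees N n. \<Sum>i<n. if b \<in> B i then path_weight N x b else 0)"
    using W by (intro sum_mono2 sum_nonneg) auto
  also have "\<dots> = (\<Sum>i<n. \<Sum>b\<in>B i. path_weight N x b)"
    by (subst sum.swap, intro sum.cong refl sum.mono_neutral_cong_right) (auto simp: B_def)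
  also have "\<dots> \<le> (\<Sum>i<n. 3 / real (Suc N) * (\<Sum>b\<in>grid_trees N n. path_weight N x b))"
    unfolding B_def by (intro sum_mono sum_path_weight_at_node N x) auto
  also have "\<dots> = 3 * real n / real (Suc N) * (\<Sum>b\<in>grid_trees N n. path_weight N x b)"
    by simp
  finally show ?thesis .
qed

lemma sum_path_weight_outside:
  assumes N: "N > 0" and b: "b \<in> grid_trees N n"
    and G: "measure_pmf.prob (tree_pmf n (bias N b)) G > 1 - \<gamma>"
  shows "(\<Sum>x\<in>cube n - G. path_weight N x b) \<le> \<gamma>"
proof -
  have "(\<Sum>x\<in>cube n - G. path_weight N x b) = measure_pmf.prob (tree_pmf n (bias N b)) (cube n - G)"
    by (simp add: measure_measure_pmf_finite pmf_grid_tree[OF N b])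
  also have "\<dots> \<le> measure_pmf.prob (tree_pmf n (bias N b)) (- G)"
    by (intro measure_pmf.finite_measure_mono) auto
  also have "\<dots> \<le> \<gamma>"
    using G measure_pmf.prob_compl[of G "tree_pmf n (bias N b)"] by (simp add: Compl_eq_Diff_UNIV)
  finally show ?thesis .
qed

text \<open>
  Averaging over uniform \<open>b\<close> and \<open>x\<close> drawn from the tree of \<open>b\<close>. Shifting along \<open>x\<close> is injective in
  \<open>b\<close> and does not decrease the weight of \<open>x\<close>, so \<open>x \<notin> G (shift_path x b)\<close> is no likelier than
  \<open>x \<notin> G b\<close>.
\<close>

lemma exists_good_pair:
  assumes N: "N > 0" and small: "2 * \<gamma> + 3 * real n / real (Suc N) < 1"
    and G: "\<And>b. b \<in> grid_trees N n \<Longrightarrow> measure_pmf.prob (tree_pmf n (bias N b)) (G b) > 1 - \<gamma>"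
  shows "\<exists>b x. b \<in> grid_trees N n \<and> x \<in> cube n \<and> shift_path x b \<in> grid_trees N n \<and> x \<in> G b \<and> x \<in> G (shift_path x b)"
proof (rule ccontr)
  let ?F = "grid_trees N n" and ?W = "path_weight N"
  assume none: "\<not> ?thesis"
  \<comment> \<open>The three ways in which a pair can fail: \<open>x\<close> is bad for
    \<open>b\<close>, the shift leaves the grid, or \<open>x\<close> is bad for the shifted tree.
    The last carries the weight in the shifted tree, so that reindexing by the shift turns it into
    the first.\<close>
  define a1 a2 a3 where "a1 b x = (if x \<notin> G b then ?W x b else 0)"
    and "a2 b x = (if leaves_grid N x b then ?W x b else 0)"
    and "a3 b x = (if \<not> leaves_grid N x b \<and> x \<notin> G (shift_path x b) then ?W x (shift_path x b) else 0)" for b x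
  have nonneg: "0 \<le> a1 b x" "0 \<le> a2 b x" "0 \<le> a3 b x" if "b \<in> ?F" "x \<in> cube n" for b x
    using path_weight_pos[OF N that] path_weight_mono_shift[OF N that]
    by (auto simp: a1_def a2_def a3_def)
  have le: "?W x b \<le> a1 b x + a2 b x + a3 b x" if "b \<in> ?F" "x \<in> cube n" for b x
  proof -
    have "x \<notin> G b \<or> leaves_grid N x b \<or> (\<not> leaves_grid N x b \<and> x \<notin> G (shift_path x b))"
      using none shift_in_grid_trees[OF that] that by blast
    then show ?thesis
      using nonneg[OF that] path_weight_mono_shift[OF N that]
      by (elim disjE) (auto simp: a1_def a2_def a3_def split: if_splits)
  qed
  have one: "(\<Sum>x\<in>cube n. ?W x b) = 1" if "b \<in> ?F" for b
  proof -
    have "(\<Sum>x\<in>cube n. ?W x b) = (\<Sum>x\<in>cube n. pmf (tree_pmf n (bias N b)) x)"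
      by (simp add: pmf_grid_tree[OF N that])
    then show ?thesis by (simp add: sum_pmf_eq_1 set_tree_pmf)
  qed
  have outside: "(\<Sum>x\<in>cube n. a1 b x) \<le> \<gamma>" if "b \<in> ?F" for b
  proof -
    have "(\<Sum>x\<in>cube n. a1 b x) = (\<Sum>x\<in>cube n - G b. ?W x b)"
      by (intro sum.mono_neutral_cong_right) (auto simp: a1_def)
    then show ?thesis using sum_path_weight_outside[OF N that G[OF that]] by simp
  qed
  then have s1: "(\<Sum>b\<in>?F. \<Sum>x\<in>cube n. a1 b x) \<le> \<gamma> * card ?F"
    using sum_bounded_above[of ?F "\<lambda>b. \<Sum>x\<in>cube n. a1 b x" \<gamma>] by (simp add: mult.commute)
  have s2: "(\<Sum>b\<in>?F. \<Sum>x\<in>cube n. a2 b x) \<le> 3 * real n / real (Suc N) * card ?F"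
  proof -
    have "(\<Sum>b\<in>?F. \<Sum>x\<in>cube n. a2 b x) = (\<Sum>x\<in>cube n. \<Sum>b | b \<in> ?F \<and> leaves_grid N x b. ?W x b)"
      by (subst sum.swap, intro sum.cong refl sum.mono_neutral_cong_right) (auto simp: a2_def)
    also have "\<dots> \<le> (\<Sum>x\<in>cube n. 3 * real n / real (Suc N) * (\<Sum>b\<in>?F. ?W x b))"
      by (intro sum_mono sum_path_weight_leaves_grid N)
    also have "\<dots> = 3 * real n / real (Suc N) * (\<Sum>b\<in>?F. \<Sum>x\<in>cube n. ?W x b)"
      by (simp only: sum_distrib_left[symmetric]) (subst sum.swap, rule refl)
    finally show ?thesis by (simp add: one)
  qed
  have s3: "(\<Sum>b\<in>?F. \<Sum>x\<in>cube n. a3 b x) \<le> \<gamma> * card ?F"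
  proof -
    have "(\<Sum>b\<in>?F. a3 b x) \<le> (\<Sum>b\<in>?F. a1 b x)" if x: "x \<in> cube n" for x
    proof -
      let ?H = "{b \<in> ?F. \<not> leaves_grid N x b}"
      have "(\<Sum>b\<in>?F. a3 b x) = (\<Sum>b\<in>?H. a1 (shift_path x b) x)"
        by (intro sum.mono_neutral_cong_right) (auto simp: a3_def a1_def)
      also have "\<dots> = (\<Sum>b\<in>shift_path x ` ?H. a1 b x)"
        by (subst sum.reindex) (auto intro: inj_on_subset[OF inj_shift])
      also have "\<dots> \<le> (\<Sum>b\<in>?F. a1 b x)"
        using shift_in_grid_trees[OF _ x] nonneg(1)[OF _ x] by (intro sum_mono2) auto
      finally show ?thesis .
    qed
    then have "(\<Sum>x\<in>cube n. \<Sum>b\<in>?F. a3 b x) \<le> (\<Sum>x\<in>cube n. \<Sum>b\<in>?F. a1 b x)"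
      by (rule sum_mono)
    then show ?thesis
      using s1 by (simp add: sum.swap[of _ "cube n" ?F])
  qed
  \<comment> \<open>Each tree has total weight one, while the three failures together cover strictly
    less than that on average.\<close>
  have "real (card ?F) = (\<Sum>b\<in>?F. \<Sum>x\<in>cube n. ?W x b)"
    by (simp add: one)
  also have "\<dots> \<le> (\<Sum>b\<in>?F. \<Sum>x\<in>cube n. a1 b x + a2 b x + a3 b x)"
    by (intro sum_mono le)
  also have "\<dots> \<le> \<gamma> * card ?F + 3 * real n / real (Suc N) * card ?F + \<gamma> * card ?F"
    unfolding sum.distrib by (intro add_mono s1 s2 s3)
  also have "\<dots> = (2 * \<gamma> + 3 * real n / real (Suc N)) * card ?F"
    by (simp add: algebra_simps)
  also have "\<dots> < 1 * real (card ?F)"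
    using small grid_trees_nonempty[of N n] by (intro mult_strict_right_mono) (auto simp: card_gt_0_iff)
  finally show False by simp
qed

section \<open>The lower bound\<close>

text \<open>Biases in [1/4, 3/4] give every prefix positive probability, so the law of every oracle
  answer is forced.\<close>

lemma prefix_oracle_tree:
  assumes "prefix_oracle n (tree_pmf n p) orc" "\<And>v. length v < n \<Longrightarrow> p v \<in> {1/4..3/4}" "length w < n"
  shows "orc w = map_pmf ((@) w) (tree_pmf (n - length w) (\<lambda>v. p (w @ v)))"
proof -
  have p: "0 < p v \<and> p v < 1" if "length v < n" for v
    using assms(2)[OF that] by auto
  have w: "length w \<le> n" using assms(3) by simp
  have "orc w = cond_pmf (tree_pmf n p) {y. prefix w y}"
    using assms(1,3) cond_tree_pmf(1)[of w n p, OF w p] by (simp add: prefix_oracle_def)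
  also have "\<dots> = map_pmf ((@) w) (tree_pmf (n - length w) (\<lambda>v. p (w @ v)))"
    by (rule cond_tree_pmf(2)[of w n p, OF w p])
  finally show ?thesis .
qed

lemma exists_prefix_oracle_tree:
  assumes "\<And>v. length v < n \<Longrightarrow> p v \<in> {1/4..3/4}"
  shows "prefix_oracle n (tree_pmf n p) (\<lambda>w. cond_pmf (tree_pmf n p) {y. prefix w y})"
  unfolding prefix_oracle_def
proof (intro allI impI conjI)
  fix w :: bits assume "length w < n"
  then have w: "length w \<le> n" by simp
  have p: "0 < p v \<and> p v < 1" if "length v < n" for v
    using assms[OF that] by auto
  have "set_pmf (tree_pmf n p) \<inter> {y. prefix w y} \<noteq> {}"
    using cond_tree_pmf(1)[of w n p, OF w p] measure_Int_set_pmf[of "tree_pmf n p" "{y. prefix w y}"]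
    by (auto simp: Int_commute)
  then show "set_pmf (cond_pmf (tree_pmf n p) {y. prefix w y}) \<subseteq> {y \<in> cube n. prefix w y}"
    using set_tree_pmf[of n p] by auto
qed simp

text \<open>Below a prefix on the path to \<open>x\<close> the two laws are a tree and its tilt
  along the rest of \<open>x\<close>; below any other prefix they coincide.\<close>

lemma chi_bound_prefix_oracles:
  assumes "prefix_oracle n (tree_pmf n p) orc" "prefix_oracle n (tree_pmf n (tilt \<theta> x p)) orc'"
    and p: "\<And>v. length v < n \<Longrightarrow> p v \<in> {1/4..3/4}"
    and q: "\<And>v. length v < n \<Longrightarrow> tilt \<theta> x p v \<in> {1/4..3/4}"
    and x: "x \<in> cube n" and \<theta>: "0 \<le> \<theta>" and w: "length w < n"
  shows "chi_bound (1 + 22 * \<theta>\<^sup>2) (orc w) (orc' w)"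
proof -
  have orc: "orc w = map_pmf ((@) w) (tree_pmf (n - length w) (\<lambda>v. p (w @ v)))"
    by (rule prefix_oracle_tree[OF assms(1) _ w]) (rule p)
  have orc': "orc' w = map_pmf ((@) w) (tree_pmf (n - length w) (\<lambda>v. tilt \<theta> x p (w @ v)))"
    by (rule prefix_oracle_tree[OF assms(2) _ w]) (rule q)
  show ?thesis
  proof (cases "prefix w x")
    case True
    define x' where "x' = drop (length w) x"
    have len: "length x' = n - length w"
      using x by (simp add: x'_def cube_def)
    have tilt: "(\<lambda>v. tilt \<theta> x p (w @ v)) = tilt \<theta> x' (\<lambda>v. p (w @ v))"
      using True by (simp add: tilt_append x'_def)
    have "chi_bound (1 + 22 * \<theta>\<^sup>2) (tree_pmf (length x') (\<lambda>v. p (w @ v)))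
        (tree_pmf (length x') (tilt \<theta> x' (\<lambda>v. p (w @ v))))"
    proof (rule chi_bound_tilt[OF \<theta>])
      fix v :: bits assume "length v < length x'"
      then have v: "length (w @ v) < n" using len by simp
      show "p (w @ v) \<in> {1/4..3/4}" by (rule p[OF v])
      show "tilt \<theta> x' (\<lambda>v. p (w @ v)) v \<in> {1/4..3/4}"
        using q[OF v] fun_cong[OF tilt, of v] by simp
    qed
    then show ?thesis
      unfolding orc orc' tilt len
      by (rule chi_bound_map)
  next
    case False
    then show ?thesis
      unfolding orc orc' tilt_append
      by (auto intro!: chi_bound_refl)
  qed
qed

lemma prefix_oracle_finite:
  "prefix_oracle n \<mu> orc \<Longrightarrow> length w < n \<Longrightarrow> finite (set_pmf (orc w))"
  unfolding prefix_oracle_def by (rule finite_subset[OF _ finite_cube[of n]]) blast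

theorem theorem7p13:
  "\<exists>\<gamma> \<eta> c :: real. 0 < \<gamma> \<and> \<gamma> < 1 \<and> 0 < \<eta> \<and> \<eta> < 1 \<and> 0 < c \<and>
     (\<forall>(n :: nat) (\<epsilon> :: real) (A :: prefix_algorithm).
        4.5 * 10 ^ 16 \<le> real n \<longrightarrow> 0 < \<epsilon> \<longrightarrow> \<epsilon> < exp (- 11) \<longrightarrow>
        randomized_algorithm n A \<longrightarrow>
        (\<forall>\<mu>. set_pmf \<mu> \<subseteq> cube n \<longrightarrow>
           (\<exists>G \<subseteq> cube n. measure_pmf.prob \<mu> G > 1 - \<gamma> \<and>
              (\<forall>x\<in>G. \<forall>orc. prefix_oracle n \<mu> orc \<longrightarrow>
                 \<P>(\<omega> in execution_space A orc. \<exists>v. outputs A x \<omega> v \<and>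
                      (1 - \<epsilon>) * pmf \<mu> x \<le> v \<and> v \<le> (1 + \<epsilon>) * pmf \<mu> x) > 1 - \<eta>))) \<longrightarrow>
        (\<exists>\<mu> x. set_pmf \<mu> \<subseteq> cube n \<and> x \<in> cube n \<and>
           (\<forall>orc. prefix_oracle n \<mu> orc \<longrightarrow>
              expected_samples A orc x \<ge> ennreal (c * (real n)\<^sup>2 / \<epsilon>\<^sup>2))))"
proof (rule exI[of _ "1/10"], rule exI[of _ "1/10"], rule exI[of _ "1/5390"], intro conjI allI impI)
  fix n :: nat and \<epsilon> :: real and A :: prefix_algorithm
  assume n: "4.5 * 10 ^ 16 \<le> real n" and \<epsilon>: "0 < \<epsilon>" "\<epsilon> < exp (- 11)" and A: "randomized_algorithm n A"
    and correct: "\<forall>\<mu>. set_pmf \<mu> \<subseteq> cube n \<longrightarrow>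
           (\<exists>G \<subseteq> cube n. measure_pmf.prob \<mu> G > 1 - 1/10 \<and>
              (\<forall>x\<in>G. \<forall>orc. prefix_oracle n \<mu> orc \<longrightarrow>
                 \<P>(\<omega> in execution_space A orc. \<exists>v. outputs A x \<omega> v \<and>
                      (1 - \<epsilon>) * pmf \<mu> x \<le> v \<and> v \<le> (1 + \<epsilon>) * pmf \<mu> x) > 1 - 1/10))"
  \<comment> \<open>5390 = 49 * 110, from \<open>N \<ge> n / (7 * \<epsilon>)\<close>, from
    \<open>Suc t \<ge> N^2 / 11\<close> and from the bound \<open>Q \<le> Suc t / 10\<close> needed
    for Markov's inequality.\<close>
  define Q where "Q = 1/5390 * (real n)\<^sup>2 / \<epsilon>\<^sup>2"
  \<comment> \<open>The left side is 72.5, which yields the numerical bound 1/72 on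
    \<epsilon>.\<close>
  have "1 + 11 + 11\<^sup>2 / 2 \<le> exp (11 :: real)"
    by (rule exp_lower_Taylor_quadratic) simp
  then have "exp (- 11) \<le> (1 :: real) / 72"
    by (simp add: exp_minus field_simps)
  with \<epsilon> have \<epsilon>72: "\<epsilon> < 1/72" by linarith
  \<comment> \<open>The largest \<open>N\<close> for which the total gain
    \<open>n * (2 / (3 * N))\<close> along the path is still at least
    \<open>4 * \<epsilon>\<close>.\<close>
  define N where "N = nat \<lfloor>real n / (6 * \<epsilon>)\<rfloor>"
  \<comment> \<open>As 1/6 - 1/7 = 1/42, this bound absorbs the rounding in \<open>N\<close> when 6
    is replaced by 7.\<close>
  have big: "42 \<le> real n / \<epsilon>"
  proof -
    have "42 * \<epsilon> \<le> 1" using \<epsilon>72 by simp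
    also have "1 \<le> real n" using n by simp
    finally show ?thesis using \<epsilon> by (simp add: pos_le_divide_eq)
  qed
  have "0 \<le> real n / (6 * \<epsilon>)" using \<epsilon> by simp
  then have N_le: "real N \<le> real n / (6 * \<epsilon>)" and N_ge: "real n / (6 * \<epsilon>) < real N + 1"
    unfolding N_def by linarith+
  have N7: "real n / (7 * \<epsilon>) \<le> real N"
    using N_ge big by (simp add: divide_divide_eq_left' mult.commute)
  then have N: "N > 0"
    using big \<epsilon> by (intro gr0I) (auto simp: field_simps)
  have "3 * real n / real (Suc N) \<le> 18 * \<epsilon>"
    using N_ge \<epsilon> by (simp add: field_simps)
  then have small: "2 * (1/10) + 3 * real n / real (Suc N) < 1"
    using \<epsilon>72 by linarith
  define \<mu> where "\<mu> b = tree_pmf n (bias N b)" for b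
  have "\<forall>b. \<exists>G. G \<subseteq> cube n \<and> measure_pmf.prob (\<mu> b) G > 1 - 1/10 \<and>
      (\<forall>x\<in>G. \<forall>orc. prefix_oracle n (\<mu> b) orc \<longrightarrow>
         \<P>(\<omega> in execution_space A orc. \<exists>v. outputs A x \<omega> v \<and>
              (1 - \<epsilon>) * pmf (\<mu> b) x \<le> v \<and> v \<le> (1 + \<epsilon>) * pmf (\<mu> b) x) > 1 - 1/10)"
    using correct set_tree_pmf unfolding \<mu>_def by blast
  then obtain G where G: "\<And>b. measure_pmf.prob (\<mu> b) (G b) > 1 - 1/10"
    and G_prob: "\<And>b x orc. x \<in> G b \<Longrightarrow> prefix_oracle n (\<mu> b) orc \<Longrightarrow>
        \<P>(\<omega> in execution_space A orc. \<exists>v. outputs A x \<omega> v \<and>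
              v \<in> {(1 - \<epsilon>) * pmf (\<mu> b) x..(1 + \<epsilon>) * pmf (\<mu> b) x}) > 9/10"
    by (auto dest!: choice)
  obtain b x where b: "b \<in> grid_trees N n" and x: "x \<in> cube n"
    and b': "shift_path x b \<in> grid_trees N n" and xG: "x \<in> G b" "x \<in> G (shift_path x b)"
    using exists_good_pair[OF N small, of G] G unfolding \<mu>_def by blast
  define \<theta> where "\<theta> = 1 / (2 * real N)"
  define b2 where "b2 = shift_path x b"
  define I J where "I = {(1 - \<epsilon>) * pmf (\<mu> b) x..(1 + \<epsilon>) * pmf (\<mu> b) x}"
    and "J = {(1 - \<epsilon>) * pmf (\<mu> b2) x..(1 + \<epsilon>) * pmf (\<mu> b2) x}"
  \<comment> \<open>By Bernoulli's inequality the shift multiplies the mass of \<open>x\<close> by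
    at least \<open>1 + 4 * \<epsilon>\<close>, and
    \<open>(1 - \<epsilon>) * (1 + 4 * \<epsilon>)\<close> exceeds \<open>1 + \<epsilon>\<close>
    because \<open>4 * \<epsilon> < 2\<close>. So \<open>I\<close> lies entirely below
    \<open>J\<close>.\<close>
  have IJ: "I \<inter> J = {}"
  proof -
    have m: "pmf (\<mu> b) x > 0"
      using path_weight_pos[OF N b x] by (simp add: \<mu>_def pmf_grid_tree[OF N b x])
    have "6 * \<epsilon> * real N \<le> real n"
      using N_le \<epsilon> by (simp add: pos_le_divide_eq mult.commute)
    then have "4 * \<epsilon> \<le> real n * (2 / (3 * real N))"
      using N by (simp add: field_simps)
    also have "1 + \<dots> \<le> (1 + 2 / (3 * real N)) ^ n"
      by (rule Bernoulli_inequality) (simp add: order_trans[of _ 0])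
    finally have "(1 + 4 * \<epsilon>) * pmf (\<mu> b) x \<le> (1 + 2 / (3 * real N)) ^ n * pmf (\<mu> b) x"
      using m by (intro mult_right_mono) auto
    also have "\<dots> \<le> pmf (\<mu> b2) x"
      using path_weight_shift[OF N b x]
      by (simp add: \<mu>_def b2_def pmf_grid_tree[OF N b x] pmf_grid_tree[OF N b' x])
    finally have "(1 - \<epsilon>) * ((1 + 4 * \<epsilon>) * pmf (\<mu> b) x) \<le> (1 - \<epsilon>) * pmf (\<mu> b2) x"
      using \<epsilon>72 by (intro mult_left_mono) auto
    moreover have "(1 + \<epsilon>) * pmf (\<mu> b) x < (1 - \<epsilon>) * (1 + 4 * \<epsilon>) * pmf (\<mu> b) x"
    proof (rule mult_strict_right_mono[OF _ m])
      have "\<epsilon> * (4 * \<epsilon>) < \<epsilon> * 2"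
        using \<epsilon> \<epsilon>72 by (intro mult_strict_left_mono) auto
      then show "1 + \<epsilon> < (1 - \<epsilon>) * (1 + 4 * \<epsilon>)" by (simp add: algebra_simps)
    qed
    ultimately show ?thesis by (auto simp: I_def J_def mult.assoc)
  qed
  \<comment> \<open>Since \<open>22 * \<theta>^2 = 11 / (2 * N^2)\<close>, this is the largest
    \<open>t\<close> with \<open>t * (22 * \<theta>^2) \<le> 1/2\<close>, which keeps the
    accumulated factor below 2.\<close>
  define t where "t = nat \<lfloor>(real N)\<^sup>2 / 11\<rfloor>"
  have "0 \<le> (real N)\<^sup>2 / 11" by simp
  then have t_le: "real t \<le> (real N)\<^sup>2 / 11" and t_ge: "(real N)\<^sup>2 / 11 \<le> real (Suc t)"
    unfolding t_def of_nat_Suc by linarith+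
  have Mt: "(1 + 22 * \<theta>\<^sup>2) ^ t \<le> 2"
  proof -
    have "(1 + 22 * \<theta>\<^sup>2) ^ t \<le> exp (22 * \<theta>\<^sup>2) ^ t"
      by (intro power_mono exp_ge_add_one_self) simp
    also have "\<dots> = exp (real t * (22 * \<theta>\<^sup>2))"
      by (rule exp_of_nat_mult[symmetric])
    also have "real t * (22 * \<theta>\<^sup>2) \<le> (real N)\<^sup>2 / 11 * (22 * \<theta>\<^sup>2)"
      using t_le by (rule mult_right_mono) simp
    also have "\<dots> = 1/2"
      using N by (simp add: \<theta>_def power_divide power_mult_distrib)
    also have "exp (1/2 :: real) \<le> 2"
      using exp_bound_half[of "1/2 :: real"] by simp
    finally show ?thesis by simp
  qed
  have Q_le: "Q \<le> real (Suc t) / 10"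
  proof -
    have "(real n / (7 * \<epsilon>))\<^sup>2 \<le> (real N)\<^sup>2"
      using N7 \<epsilon> by (intro power_mono) auto
    then have "Q \<le> (real N)\<^sup>2 / 11 / 10"
      by (simp add: Q_def power_divide power_mult_distrib)
    then show ?thesis using t_ge by simp
  qed
  have Q: "Q \<ge> 0" by (simp add: Q_def)
  have p: "bias N b v \<in> {1/4..3/4}" if "length v < n" for v
    using bias_bounds[OF N b that] by simp
  have q: "tilt \<theta> x (bias N b) v \<in> {1/4..3/4}" if "length v < n" for v
    using bias_bounds[OF N b' that] by (simp add: bias_shift \<theta>_def)
  have \<mu>2: "\<mu> b2 = tree_pmf n (tilt \<theta> x (bias N b))"
    by (simp add: \<mu>_def b2_def bias_shift \<theta>_def)
  have large: "ennreal Q \<le> expected_samples A orc x"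
    if orc: "prefix_oracle n (\<mu> b) orc" and orc': "prefix_oracle n (\<mu> b2) orc'" for orc orc'
  proof -
    have chi: "chi_bound (1 + 22 * \<theta>\<^sup>2) (orc w) (orc' w)" if "length w < n" for w
      by (rule chi_bound_prefix_oracles[OF orc[unfolded \<mu>_def] orc'[unfolded \<mu>2] _ _ x _ that])
        (use p q in \<open>auto simp: \<theta>_def\<close>)
    have "ennreal Q < expected_samples A orc x"
    proof (rule two_point_lower_bound[OF A x _ _ IJ _ _ chi _ Mt _ _ Q Q_le])
      show "\<P>(\<omega> in execution_space A orc. \<exists>v. outputs A x \<omega> v \<and> v \<in> I) > 9/10"
        unfolding I_def using xG(1) orc by (rule G_prob)
      show "\<P>(\<omega> in execution_space A orc'. \<exists>v. outputs A x \<omega> v \<and> v \<in> J) > 9/10"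
        unfolding J_def b2_def using xG(2) orc'[unfolded b2_def] by (rule G_prob)
    qed (use orc orc' in \<open>auto simp: I_def J_def intro: prefix_oracle_finite\<close>)
    then show ?thesis by simp
  qed
  \<comment> \<open>The lower bound is claimed for every oracle of \<open>\<mu> b\<close>; the
    comparison also needs some oracle for the shifted tree, and conditioning provides one.\<close>
  have "prefix_oracle n (\<mu> b2) (\<lambda>w. cond_pmf (\<mu> b2) {y. prefix w y})"
    unfolding \<mu>2 using q by (rule exists_prefix_oracle_tree)
  then show "\<exists>\<mu> x. set_pmf \<mu> \<subseteq> cube n \<and> x \<in> cube n \<and>
      (\<forall>orc. prefix_oracle n \<mu> orc \<longrightarrow>
        expected_samples A orc x \<ge> ennreal (1/5390 * (real n)\<^sup>2 / \<epsilon>\<^sup>2))"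
    unfolding Q_def[symmetric] using large x set_tree_pmf[of n "bias N b"]
    by (intro exI[of _ "\<mu> b"] exI[of _ x]) (auto simp: \<mu>_def)
qed simp_all

end
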